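(* Let $f_1,\dots,f_n$, $W$, the iterates $x_{(i)}(k)$, and the constants $L_h, L_{\bar f}, C, D,\beta$ be as in the context, and let $\bar x(k)=\frac1n\sum_{i=1}^n x_{(i)}(k)$ and $\bar r(k)=\bar f(\bar x(k))-\bar f^*$. If the stepsize $\alpha>0$ satisfies $$\alpha\le\min\Big\{\frac{1+\lambda_n(W)}{L_h},\ \frac{1}{L_{\bar f}}\Big\}=O(1/L_h),$$ then while $$\bar r(k)>C\sqrt2\cdot\frac{\alpha L_hD}{1-\beta}=O\Big(\frac{\alpha}{1-\beta}\Big),$$ the reduction of $\bar r(k)$ obeys $$\bar r(k+1)\le\bar r(k)-O(\alpha\,\bar r^2(k)),$$ and therefore $$\bar r(k)\le O\Big(\frac1{\alpha k}\Big).$$ In other words, $\bar r(k)$ decreases at a minimal rate of $O(\frac1{\alpha k})=O(1/k)$ until reaching $O(\frac{\alpha}{1-\beta})$.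
   Context: Setting: $n$ agents in a network seek to minimize $f(x)=\sum_{i=1}^n f_i(x)$ over $x\in\mathbb{R}^p$; the set $\mathcal{X}^*$ of minimizers of $f$ is assumed non-empty. Assumptions: (a) For $i=1,\dots,n$, $f_i$ is proper closed convex, lower bounded, and Lipschitz differentiable, i.e. $\nabla f_i$ is Lipschitz continuous with constant $L_{f_i}>0$. (b) The network has a synchronized clock (all agents apply the iteration at the same time intervals), the network is connected, and the mixing matrix $W=[w_{ij}]\in\mathbb{R}^{n\times n}$ is symmetric and doubly stochastic, with eigenvalues $1=\lambda_1(W)\ge\dots\ge\lambda_n(W)\ge-1$ and $\beta:=\max\{|\lambda_2(W)|,|\lambda_n(W)|\}<1$. Iteration: $x_{(i)}(0)=0$ and $x_{(i)}(k+1)=\sum_{j=1}^n w_{ij}x_{(j)}(k)-\alpha\nabla f_i(x_{(i)}(k))$, $i=1,\dots,n$. Notation: $\bar f=\frac1n\sum_{i=1}^n f_i$, $\bar f^*=\bar f(x^* )$ for $x^*\in\mathcal{X}^*$; $L_h=\max_iL_{f_i}$; $L_{\bar f}=\frac1n\sum_{i=1}^nL_{f_i}$; $D=\sqrt{2L_h(\sum_{i=1}^n f_i(0)-f^o)}$ with $f^o=\sum_{i=1}^n f_i(x_{(i)}^o)$, $x_{(i)}^o=\arg\min_x f_i(x)$. Let $$\xi_\alpha([x_{(i)}])=-\frac12\sum_{i,j=1}^n w_{ij}x_{(i)}^Tx_{(j)}+\sum_{i=1}^n\Big(\frac12\|x_{(i)}\|^2+\alpha f_i(x_{(i)})\Big),\qquad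 [x_{(i)}]=[x_{(1)};\dots;x_{(n)}]\in\mathbb{R}^{np}.$$ With $[\tilde x_{(i)}]$ an element of the set of minimizers of $\xi_\alpha$ and $x^*\in\mathcal{X}^*$, $$C:=\frac1{\sqrt n}\big(\|[x_{(i)}(0)-\tilde x_{(i)}]\|+\|[\tilde x_{(i)}-x^*]\|\big),$$ where $[\cdot]$ denotes stacking over $i=1,\dots,n$ and norms are Euclidean. *)

theory Defs
  imports "HOL-Analysis.Analysis" "Jordan_Normal_Form.Char_Poly"
begin

text \<open>
  Agents are numbered \<open>0, \<dots>, n - 1\<close>, and \<open>'a::euclidean_space\<close> plays the role of the space of
  decision variables. A stacked vector \<open>[x\<^sub>(\<^sub>i\<^sub>)]\<close> is a function \<open>nat \<Rightarrow> 'a\<close> of which only the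
  values at \<open>i < n\<close> are ever used.
\<close>

definition grad :: "('a::real_inner \<Rightarrow> real) \<Rightarrow> 'a \<Rightarrow> 'a" where
  "grad g x = (THE D. GDERIV g x :> D)"

abbreviation minimizer :: "('b \<Rightarrow> real) \<Rightarrow> 'b \<Rightarrow> bool" where
  "minimizer g x \<equiv> is_arg_min g (\<lambda>_. True) x"

text \<open>
  Properness and closedness (lower semicontinuity) need no separate clause: the functions are
  real-valued and differentiable everywhere.
\<close>

definition local_objectives ::
    "nat \<Rightarrow> (nat \<Rightarrow> 'a::euclidean_space \<Rightarrow> real) \<Rightarrow> (nat \<Rightarrow> real) \<Rightarrow> bool" where
  "local_objectives n f L \<longleftrightarrow>
     (\<forall>i<n. convex_on UNIV (f i) \<and> bdd_below (range (f i)) \<and>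
            (\<forall>x. f i differentiable (at x)) \<and>
            0 < L i \<and> lipschitz_on (L i) UNIV (grad (f i)))"

text \<open>An undirected network, given as a symmetric set of ordered pairs.\<close>

definition connected_network :: "nat \<Rightarrow> (nat \<times> nat) set \<Rightarrow> bool" where
  "connected_network n E \<longleftrightarrow>
     E \<subseteq> {..<n} \<times> {..<n} \<and> sym E \<and> (\<forall>i<n. \<forall>j<n. (i, j) \<in> E\<^sup>*)"

definition doubly_stochastic :: "nat \<Rightarrow> real mat \<Rightarrow> bool" where
  "doubly_stochastic n W \<longleftrightarrow>
     (\<forall>i<n. \<forall>j<n. 0 \<le> W $$ (i, j)) \<and>
     (\<forall>i<n. (\<Sum>j<n. W $$ (i, j)) = 1) \<and>
     (\<forall>j<n. (\<Sum>i<n. W $$ (i, j)) = 1)"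

text \<open>
  The \<open>k\<close>-th largest eigenvalue for \<open>k = 1, \<dots>, n\<close>, counted with multiplicity; for a real
  symmetric matrix all \<open>n\<close> roots of the characteristic polynomial are real.
\<close>

definition eigval :: "real mat \<Rightarrow> nat \<Rightarrow> real" where
  "eigval W k = rev (sorted_list_of_multiset (proots (char_poly W))) ! (k - 1)"

definition beta :: "nat \<Rightarrow> real mat \<Rightarrow> real" where
  "beta n W = max \<bar>eigval W 2\<bar> \<bar>eigval W n\<bar>"

text \<open>
  Only neighbours exchange information. For \<open>n = 1\<close> the condition on \<open>beta\<close> is unsatisfiable,
  since then \<open>eigval W n = 1\<close>. The chain
  \<open>1 = eigval W 1 \<ge> \<dots> \<ge> eigval W n \<ge> - 1\<close> follows from symmetry and double stochasticity.
\<close>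

definition mixing_matrix :: "nat \<Rightarrow> (nat \<times> nat) set \<Rightarrow> real mat \<Rightarrow> bool" where
  "mixing_matrix n E W \<longleftrightarrow>
     W \<in> carrier_mat n n \<and> transpose_mat W = W \<and> doubly_stochastic n W \<and>
     (\<forall>i<n. \<forall>j<n. i \<noteq> j \<and> (i, j) \<notin> E \<longrightarrow> W $$ (i, j) = 0) \<and>
     beta n W < 1"

primrec dgd ::
    "nat \<Rightarrow> (nat \<Rightarrow> 'a::euclidean_space \<Rightarrow> real) \<Rightarrow> real mat \<Rightarrow> real \<Rightarrow> nat \<Rightarrow> nat \<Rightarrow> 'a" where
  "dgd n f W \<alpha> 0 = (\<lambda>i. 0)"
| "dgd n f W \<alpha> (Suc k) =
     (\<lambda>i. (\<Sum>j<n. W $$ (i, j) *\<^sub>R dgd n f W \<alpha> k j) - \<alpha> *\<^sub>R grad (f i) (dgd n f W \<alpha> k i))"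

definition xbar ::
    "nat \<Rightarrow> (nat \<Rightarrow> 'a::euclidean_space \<Rightarrow> real) \<Rightarrow> real mat \<Rightarrow> real \<Rightarrow> nat \<Rightarrow> 'a" where
  "xbar n f W \<alpha> k = (1 / real n) *\<^sub>R (\<Sum>i<n. dgd n f W \<alpha> k i)"

definition fbar :: "nat \<Rightarrow> (nat \<Rightarrow> 'a \<Rightarrow> real) \<Rightarrow> 'a \<Rightarrow> real" where
  "fbar n f x = (1 / real n) * (\<Sum>i<n. f i x)"

text \<open>In the next definitions \<open>xs\<close> is a minimizer of \<open>\<Sum>i<n. f i\<close>.\<close>

definition rbar ::
    "nat \<Rightarrow> (nat \<Rightarrow> 'a::euclidean_space \<Rightarrow> real) \<Rightarrow> real mat \<Rightarrow> real \<Rightarrow> 'a \<Rightarrow> nat \<Rightarrow> real" where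
  "rbar n f W \<alpha> xs k = fbar n f (xbar n f W \<alpha> k) - fbar n f xs"

definition xi ::
    "nat \<Rightarrow> (nat \<Rightarrow> 'a::euclidean_space \<Rightarrow> real) \<Rightarrow> real mat \<Rightarrow> real \<Rightarrow> (nat \<Rightarrow> 'a) \<Rightarrow> real" where
  "xi n f W \<alpha> x =
     - (1/2) * (\<Sum>i<n. \<Sum>j<n. W $$ (i, j) * inner (x i) (x j)) +
     (\<Sum>i<n. (1/2) * (norm (x i))\<^sup>2 + \<alpha> * f i (x i))"

definition stack_norm :: "nat \<Rightarrow> (nat \<Rightarrow> 'a::euclidean_space) \<Rightarrow> real" where
  "stack_norm n x = L2_set (\<lambda>i. norm (x i)) {..<n}"

text \<open>\<open>xt\<close> is a minimizer of \<open>xi n f W \<alpha>\<close>.\<close>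

definition C_const ::
    "nat \<Rightarrow> (nat \<Rightarrow> 'a::euclidean_space \<Rightarrow> real) \<Rightarrow> real mat \<Rightarrow> real \<Rightarrow> (nat \<Rightarrow> 'a) \<Rightarrow> 'a \<Rightarrow> real" where
  "C_const n f W \<alpha> xt xs =
     (1 / sqrt (real n)) *
     (stack_norm n (\<lambda>i. dgd n f W \<alpha> 0 i - xt i) + stack_norm n (\<lambda>i. xt i - xs))"

definition L_h :: "nat \<Rightarrow> (nat \<Rightarrow> real) \<Rightarrow> real" where
  "L_h n L = Max (L ` {..<n})"

definition L_fbar :: "nat \<Rightarrow> (nat \<Rightarrow> real) \<Rightarrow> real" where
  "L_fbar n L = (1 / real n) * (\<Sum>i<n. L i)"

text \<open>\<open>xo i\<close> is a minimizer of \<open>f i\<close>.\<close>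

definition D_const ::
    "nat \<Rightarrow> (nat \<Rightarrow> 'a::euclidean_space \<Rightarrow> real) \<Rightarrow> (nat \<Rightarrow> real) \<Rightarrow> (nat \<Rightarrow> 'a) \<Rightarrow> real" where
  "D_const n f L xo = sqrt (2 * L_h n L * ((\<Sum>i<n. f i 0) - (\<Sum>i<n. f i (xo i))))"

definition step_bound :: "nat \<Rightarrow> (nat \<Rightarrow> real) \<Rightarrow> real mat \<Rightarrow> real" where
  "step_bound n L W = min ((1 + eigval W n) / L_h n L) (1 / L_fbar n L)"

definition threshold ::
    "nat \<Rightarrow> (nat \<Rightarrow> 'a::euclidean_space \<Rightarrow> real) \<Rightarrow> (nat \<Rightarrow> real) \<Rightarrow> (nat \<Rightarrow> 'a) \<Rightarrow>
     real mat \<Rightarrow> real \<Rightarrow> (nat \<Rightarrow> 'a) \<Rightarrow> 'a \<Rightarrow> real" where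
  "threshold n f L xo W \<alpha> xt xs =
     C_const n f W \<alpha> xt xs * sqrt 2 * (\<alpha> * L_h n L * D_const n f L xo / (1 - beta n W))"

end

theory Submission
  imports Defs "Jordan_Normal_Form.Spectral_Radius"
begin

text \<open>
  The iteration is gradient descent with unit step on \<open>xi\<close>, whose gradient is Lipschitz with constant
  \<open>1 - eigval W n + \<alpha> * L_h n L \<le> 2\<close>. Hence \<open>xi\<close> never increases, which bounds the stacked local
  gradients by \<open>D\<close>, and the distance to a minimizer of \<open>xi\<close> never increases, which keeps the average
  within \<open>C\<close> of \<open>xs\<close>. On vectors summing to zero \<open>W\<close> contracts by \<open>beta n W\<close>, so the agents stay within
  \<open>\<alpha> * D / (1 - beta n W)\<close> of their average. The average thus performs gradient descent on \<open>fbar\<close>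
  with a gradient error \<open>e \<le> \<alpha> * L_h n L * D / (1 - beta n W)\<close>, giving
  \<open>r (k + 1) \<le> r k - \<alpha> / 2 * (norm G ^ 2 - e ^ 2)\<close>, where \<open>G\<close> is the gradient of \<open>fbar\<close> at the
  average. By convexity \<open>r k \<le> C * norm G\<close>, and above the threshold \<open>e ^ 2 \<le> (r k / C) ^ 2 / 2\<close>.
\<close>

section \<open>Spectral theorem for real symmetric matrices\<close>

text \<open>A complex eigenpair exists because the spectrum is nonempty. With the eigenvector
  written as \<open>x + i y\<close>, symmetry equates \<open>y^T A x\<close> with
  \<open>x^T A y\<close>, which forces \<open>Im c\<close> times the squared norm to vanish. So
  \<open>c\<close> is real, \<open>x\<close> and \<open>y\<close> both satisfy the real eigenvector
  equation, and one of them is nonzero.\<close>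

lemma symmetric_real_eigenvector:
  fixes A :: "real mat"
  assumes A: "A \<in> carrier_mat n n" and sym: "transpose_mat A = A" and n: "0 < n"
  shows "\<exists>v l. v \<in> carrier_vec n \<and> scalar_prod v v = 1 \<and> A *\<^sub>v v = l \<cdot>\<^sub>v v"
proof -
  let ?C = "map_mat complex_of_real A"
  have C: "?C \<in> carrier_mat n n" using A by simp
  obtain z c where z: "z \<in> carrier_vec n" "z \<noteq> 0\<^sub>v n" and Cz: "?C *\<^sub>v z = c \<cdot>\<^sub>v z"
    using spectrum_non_empty[OF C n] A
    unfolding spectrum_def eigenvalue_def eigenvector_def by auto
  define x where "x = vec n (\<lambda>i. Re (vec_index z i))"
  define y where "y = vec n (\<lambda>i. Im (vec_index z i))"
  have xy: "x \<in> carrier_vec n" "y \<in> carrier_vec n" by (auto simp: x_def y_def)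
  have symA: "A $$ (i, j) = A $$ (j, i)" if "i < n" "j < n" for i j
    using sym A that by (metis carrier_matD index_transpose_mat(1))
  have comp: "(\<Sum>j<n. of_real (A $$ (i, j)) * vec_index z j) = c * vec_index z i" if "i < n" for i
  proof -
    have "vec_index (?C *\<^sub>v z) i = vec_index (c \<cdot>\<^sub>v z) i" using Cz by simp
    then show ?thesis using that A z
      by (simp add: scalar_prod_def mult_mat_vec_def lessThan_atLeast0)
  qed
  have re: "(\<Sum>j<n. A $$ (i, j) * vec_index x j) = Re c * vec_index x i - Im c * vec_index y i"
    if "i < n" for i
    using arg_cong[OF comp[OF that], of Re] that by (simp add: x_def y_def)
  have im: "(\<Sum>j<n. A $$ (i, j) * vec_index y j) = Re c * vec_index y i + Im c * vec_index x i"
    if "i < n" for i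
    using arg_cong[OF comp[OF that], of Im] that by (simp add: x_def y_def)
  have "(\<Sum>i<n. \<Sum>j<n. vec_index y i * A $$ (i, j) * vec_index x j)
      = (\<Sum>i<n. \<Sum>j<n. vec_index x i * A $$ (i, j) * vec_index y j)"
    by (subst sum.swap) (intro sum.cong refl, simp add: symA mult.commute mult.left_commute)
  then have "(\<Sum>i<n. vec_index y i * (\<Sum>j<n. A $$ (i, j) * vec_index x j))
      = (\<Sum>i<n. vec_index x i * (\<Sum>j<n. A $$ (i, j) * vec_index y j))"
    by (simp add: sum_distrib_left mult.assoc)
  then have "(\<Sum>i<n. vec_index y i * (Re c * vec_index x i - Im c * vec_index y i))
      = (\<Sum>i<n. vec_index x i * (Re c * vec_index y i + Im c * vec_index x i))"
    by (simp add: re im)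
  then have "0 = Im c * (\<Sum>i<n. (vec_index x i)\<^sup>2 + (vec_index y i)\<^sup>2)"
    by (simp add: algebra_simps sum.distrib sum_subtractf sum_distrib_left power2_eq_square)
  moreover have "(\<Sum>i<n. (vec_index x i)\<^sup>2 + (vec_index y i)\<^sup>2) \<noteq> 0"
  proof
    assume "(\<Sum>i<n. (vec_index x i)\<^sup>2 + (vec_index y i)\<^sup>2) = 0"
    then have "\<forall>i\<in>{..<n}. (vec_index x i)\<^sup>2 + (vec_index y i)\<^sup>2 = 0"
      by (subst (asm) sum_nonneg_eq_0_iff) auto
    then have "\<forall>i<n. vec_index z i = 0"
      by (auto simp: x_def y_def complex_eq_iff)
    then show False using z by (auto simp: vec_eq_iff)
  qed
  ultimately have c0: "Im c = 0" by simp
  have eig: "A *\<^sub>v x = Re c \<cdot>\<^sub>v x" "A *\<^sub>v y = Re c \<cdot>\<^sub>v y"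
    using re im c0 A xy by (auto simp: vec_eq_iff scalar_prod_def mult_mat_vec_def lessThan_atLeast0)
  obtain u where u: "u \<in> carrier_vec n" "u \<noteq> 0\<^sub>v n" "A *\<^sub>v u = Re c \<cdot>\<^sub>v u"
  proof (cases "x = 0\<^sub>v n")
    case True
    have "y \<noteq> 0\<^sub>v n"
    proof
      assume "y = 0\<^sub>v n"
      then have "vec_index z i = 0" if "i < n" for i
        using True that by (auto simp: x_def y_def complex_eq_iff vec_eq_iff)
      then show False using z by (auto simp: vec_eq_iff)
    qed
    then show ?thesis using that xy eig by blast
  next
    case False
    then show ?thesis using that xy eig by blast
  qed
  have pos: "0 < scalar_prod u u"
  proof -
    obtain i where "i < n" "vec_index u i \<noteq> 0" using u by (auto simp: vec_eq_iff)
    then show ?thesis using u by (auto simp: scalar_prod_def intro!: sum_pos2[of _ i])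
  qed
  let ?v = "(1 / sqrt (scalar_prod u u)) \<cdot>\<^sub>v u"
  have "scalar_prod ?v ?v = 1" using pos u by (simp add: field_simps)
  moreover have "A *\<^sub>v ?v = Re c \<cdot>\<^sub>v ?v"
    using u A by (simp add: mult_mat_vec smult_smult_assoc mult.commute)
  ultimately show ?thesis using u by (intro exI[of _ ?v]) auto
qed

text \<open>
  The reflection exchanging the unit vectors \<open>v\<close> and \<open>e\<^sub>0\<close>. For \<open>v = e\<^sub>0\<close> the division by zero
  yields the identity matrix, as it should.
\<close>

definition householder :: "nat \<Rightarrow> real vec \<Rightarrow> real mat" where
  "householder n v = mat n n (\<lambda>(i, j). (if i = j then 1 else 0) -
     (vec_index v i - (if i = 0 then 1 else 0)) * (vec_index v j - (if j = 0 then 1 else 0))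
       / (1 - vec_index v 0))"

text \<open>The key identity is \<open>|w|^2 = 2 * s\<close> for \<open>w = v - e_0\<close> and
  \<open>s = 1 - v_0\<close>: for nonzero \<open>s\<close> it makes \<open>I - w w^T / s\<close> the
  reflection in the hyperplane orthogonal to \<open>w\<close>.\<close>

lemma householder_properties:
  assumes v: "v \<in> carrier_vec n" "scalar_prod v v = 1" and n: "0 < n"
  shows "householder n v \<in> carrier_mat n n"
    and "transpose_mat (householder n v) = householder n v"
    and "householder n v * householder n v = 1\<^sub>m n"
    and "col (householder n v) 0 = v"
proof -
  define w where "w = (\<lambda>i. vec_index v i - (if i = 0 then 1 else 0))"
  define s where "s = 1 - vec_index v 0"
  have H: "householder n v = mat n n (\<lambda>(i, j). (if i = j then 1 else 0) - w i * w j / s)"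
    by (simp add: householder_def w_def s_def)
  show car: "householder n v \<in> carrier_mat n n" by (simp add: H)
  show "transpose_mat (householder n v) = householder n v"
    by (rule eq_matI) (auto simp: H mult.commute)
  have v1: "(\<Sum>i<n. (vec_index v i)\<^sup>2) = 1"
    using v by (simp add: scalar_prod_def lessThan_atLeast0 power2_eq_square)
  have "(\<Sum>i<n. (w i)\<^sup>2) = (\<Sum>i<n. (vec_index v i)\<^sup>2 + (if i = 0 then 1 - 2 * vec_index v i else 0))"
    by (intro sum.cong refl) (auto simp: w_def power2_eq_square algebra_simps)
  also have "\<dots> = 2 * s"
    using n v1 by (simp add: sum.distrib s_def)
  finally have w2: "(\<Sum>i<n. (w i)\<^sup>2) = 2 * s" .
  \<comment> \<open>For \<open>s = 0\<close> the vector \<open>w\<close> vanishes, so the quotients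
    by \<open>s\<close> contribute nothing.\<close>
  have w0: "w i = 0" if "s = 0" "i < n" for i
    using w2 that by (simp add: sum_nonneg_eq_0_iff)
  show "householder n v * householder n v = 1\<^sub>m n"
  proof (rule eq_matI)
    fix i j assume ij: "i < dim_row (1\<^sub>m n)" "j < dim_col (1\<^sub>m n)"
    have "(householder n v * householder n v) $$ (i, j)
        = (\<Sum>k<n. ((if i = k then 1 else 0) - w i * w k / s) * ((if k = j then 1 else 0) - w k * w j / s))"
      using ij by (simp add: H scalar_prod_def lessThan_atLeast0)
    also have "\<dots> = (\<Sum>k<n. (if k = j then (if i = j then 1 else 0) else 0)
        - (if k = j then w i * w j / s else 0) - (if k = i then w i * w j / s else 0)
        + (w i * w j / s\<^sup>2) * (w k)\<^sup>2)"
      by (intro sum.cong refl) (auto simp: power2_eq_square algebra_simps)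
    also have "\<dots> = (if i = j then 1 else 0) - 2 * (w i * w j / s) + (w i * w j / s\<^sup>2) * (2 * s)"
      using ij by (simp only: sum.distrib sum_subtractf sum_distrib_left[symmetric] w2) simp
    also have "\<dots> = 1\<^sub>m n $$ (i, j)"
      using ij by (cases "s = 0") (auto simp: w0 power2_eq_square)
    finally show "(householder n v * householder n v) $$ (i, j) = 1\<^sub>m n $$ (i, j)" .
  qed (use car in auto)
  have s: "w 0 = - s" by (simp add: w_def s_def)
  show "col (householder n v) 0 = v"
  proof (rule eq_vecI)
    fix i assume "i < dim_vec v"
    then have i: "i < n" using v by simp
    have "vec_index (col (householder n v) 0) i = (if i = 0 then 1 else 0) - w i * w 0 / s"
      using i n by (simp add: H)
    also have "\<dots> = (if i = 0 then 1 else 0) + w i"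
      using i by (cases "s = 0") (auto simp: s w0)
    finally show "vec_index (col (householder n v) 0) i = vec_index v i" by (simp add: w_def)
  qed (use v in \<open>auto simp: H\<close>)
qed

abbreviation diagonal :: "nat \<Rightarrow> (nat \<Rightarrow> real) \<Rightarrow> real mat" where
  "diagonal n d \<equiv> mat n n (\<lambda>(i, j). if i = j then d i else 0)"

text \<open>Deflation: conjugating by the reflection that maps a unit eigenvector to
  \<open>e_0\<close> turns the first column into \<open>l * e_0\<close>, and symmetry does the same
  to the first row; the induction hypothesis diagonalizes the remaining block. Using
  \<open>transpose_mat P\<close> as the inverse in the similarity witness encodes that
  \<open>P\<close> is orthogonal.\<close>

theorem spectral_theorem:
  fixes A :: "real mat"
  assumes "A \<in> carrier_mat n n" and "transpose_mat A = A"
  shows "\<exists>P d. similar_mat_wit A (diagonal n d) P (transpose_mat P)"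
  using assms
proof (induction n arbitrary: A)
  case 0
  then show ?case
    by (intro exI[of _ "1\<^sub>m 0"] exI[of _ "\<lambda>_. 0"] similar_mat_witI[where n = 0]) auto
next
  case (Suc n)
  note A = Suc.prems(1)
  obtain v l where v: "v \<in> carrier_vec (Suc n)" "scalar_prod v v = 1" and Av: "A *\<^sub>v v = l \<cdot>\<^sub>v v"
    using symmetric_real_eigenvector[OF Suc.prems] by auto
  define H where "H = householder (Suc n) v"
  have H: "H \<in> carrier_mat (Suc n) (Suc n)" "transpose_mat H = H" "H * H = 1\<^sub>m (Suc n)"
    and col0: "col H 0 = v"
    using householder_properties[OF v] by (auto simp: H_def)
  define B where "B = H * A * H"
  have B: "B \<in> carrier_mat (Suc n) (Suc n)" using H A by (simp add: B_def)
  have Bsym: "transpose_mat B = B"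
    using A H Suc.prems(2) unfolding B_def
    by (simp add: transpose_mult[where nr = "Suc n" and n = "Suc n" and nc = "Suc n"]
        assoc_mult_mat[where n\<^sub>1 = "Suc n" and n\<^sub>2 = "Suc n" and n\<^sub>3 = "Suc n" and n\<^sub>4 = "Suc n"])
  have AB: "A = H * B * H"
  proof -
    have "H * B = A * H"
      using A H unfolding B_def
      by (metis assoc_mult_mat left_mult_one_mat mult_carrier_mat)
    then have "H * B * H = A * (H * H)"
      using A H by (simp add: assoc_mult_mat[where n\<^sub>1 = "Suc n" and n\<^sub>2 = "Suc n"
            and n\<^sub>3 = "Suc n" and n\<^sub>4 = "Suc n"])
    then show ?thesis using A H by simp
  qed
  have simAB: "similar_mat_wit A B H (transpose_mat H)"
    using A B H AB by (intro similar_mat_witI[where n = "Suc n"]) auto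
  have Hv: "H *\<^sub>v v = unit_vec (Suc n) 0"
  proof -
    have "H *\<^sub>v v = col (H * H) 0"
      unfolding col0[symmetric] by (rule col_mult2[symmetric]) (use H in auto)
    then show ?thesis using H by simp
  qed
  have Bcol: "col B 0 = l \<cdot>\<^sub>v unit_vec (Suc n) 0"
  proof -
    have "col B 0 = (H * A) *\<^sub>v v"
      unfolding B_def using H A col0
      by (subst col_mult2[where nr = "Suc n" and n = "Suc n" and nc = "Suc n"]) auto
    also have "\<dots> = H *\<^sub>v (l \<cdot>\<^sub>v v)"
      using H A v Av
      by (simp add: assoc_mult_mat_vec[where n\<^sub>1 = "Suc n" and n\<^sub>2 = "Suc n" and n\<^sub>3 = "Suc n"])
    also have "\<dots> = l \<cdot>\<^sub>v unit_vec (Suc n) 0" using H v Hv by (simp add: mult_mat_vec)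
    finally show ?thesis .
  qed
  have Bi0: "B $$ (i, 0) = (if i = 0 then l else 0)" if "i < Suc n" for i
  proof -
    have "B $$ (i, 0) = vec_index (col B 0) i" using B that by simp
    then show ?thesis using that by (simp add: Bcol unit_vec_def)
  qed
  have B0i: "B $$ (0, i) = (if i = 0 then l else 0)" if "i < Suc n" for i
    using Bi0[OF that] Bsym B that by (metis carrier_matD index_transpose_mat(1) zero_less_Suc)
  define A' where "A' = mat n n (\<lambda>(i, j). B $$ (Suc i, Suc j))"
  have A': "A' \<in> carrier_mat n n" by (simp add: A'_def)
  have "transpose_mat A' = A'"
  proof (rule eq_matI)
    fix i j assume "i < dim_row A'" "j < dim_col A'"
    then show "transpose_mat A' $$ (i, j) = A' $$ (i, j)"
      using Bsym B by (simp add: A'_def) (metis Suc_less_eq carrier_matD index_transpose_mat(1))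
  qed (auto simp: A'_def)
  then obtain P d where Pd: "similar_mat_wit A' (diagonal n d) P (transpose_mat P)"
    using Suc.IH[OF A'] by blast
  have P: "P \<in> carrier_mat n n" using similar_mat_witD2[OF A' Pd] by auto
  let ?L = "mat 1 1 (\<lambda>_. l)"
  let ?P = "four_block_mat (1\<^sub>m 1) (0\<^sub>m 1 n) (0\<^sub>m n 1) P"
  have Bblock: "B = four_block_mat ?L (0\<^sub>m 1 n) (0\<^sub>m n 1) A'"
    using B by (intro eq_matI) (auto simp: Bi0 B0i A'_def four_block_mat_def Let_def)
  have "similar_mat_wit (four_block_mat ?L (0\<^sub>m 1 n) (0\<^sub>m n 1) A')
      (four_block_mat ?L (0\<^sub>m 1 n) (0\<^sub>m n 1) (diagonal n d)) ?P
      (four_block_mat (1\<^sub>m 1) (0\<^sub>m 1 n) (0\<^sub>m n 1) (transpose_mat P))"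
    using P by (intro similar_mat_wit_four_block[OF similar_mat_wit_refl Pd]) (auto simp: A')
  moreover have "four_block_mat (1\<^sub>m 1) (0\<^sub>m 1 n) (0\<^sub>m n 1) (transpose_mat P) = transpose_mat ?P"
    using P by (subst transpose_four_block_mat[of _ 1 1 _ n _ n]) auto
  moreover have "four_block_mat ?L (0\<^sub>m 1 n) (0\<^sub>m n 1) (diagonal n d)
      = diagonal (Suc n) (case_nat l d)"
    by (rule eq_matI) (auto simp: four_block_mat_def Let_def split: nat.splits)
  ultimately have simB: "similar_mat_wit B (diagonal (Suc n) (case_nat l d)) ?P (transpose_mat ?P)"
    by (simp add: Bblock)
  have PP: "?P \<in> carrier_mat (Suc n) (Suc n)" using P by auto
  have "similar_mat_wit A (diagonal (Suc n) (case_nat l d)) (H * ?P) (transpose_mat (H * ?P))"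
    using similar_mat_wit_trans[OF simAB simB] H PP
    by (simp add: transpose_mult[where nr = "Suc n" and n = "Suc n" and nc = "Suc n"])
  then show ?case by blast
qed

section \<open>The spectrum of the mixing matrix\<close>

text \<open>\<open>u k\<close> is the \<open>k\<close>-th eigenvector, with eigenvalue
  \<open>d k\<close>. The first two clauses are completeness and orthonormality; the factorization
  of the characteristic polynomial ties \<open>d\<close> to \<open>eigval\<close>, multiplicities
  included.\<close>

definition eigenbasis :: "nat \<Rightarrow> real mat \<Rightarrow> (nat \<Rightarrow> nat \<Rightarrow> real) \<Rightarrow> (nat \<Rightarrow> real) \<Rightarrow> bool" where
  "eigenbasis n A u d \<longleftrightarrow>
     (\<forall>i<n. \<forall>j<n. (\<Sum>k<n. u k i * u k j) = (if i = j then 1 else 0)) \<and>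
     (\<forall>i<n. \<forall>j<n. (\<Sum>k<n. u i k * u j k) = (if i = j then 1 else 0)) \<and>
     (\<forall>i<n. \<forall>j<n. A $$ (i, j) = (\<Sum>k<n. d k * u k i * u k j)) \<and>
     char_poly A = (\<Prod>a\<leftarrow>map d [0..<n]. [:- a, 1:])"

lemma eigenbasis_exists:
  fixes A :: "real mat"
  assumes A: "A \<in> carrier_mat n n" and sym: "transpose_mat A = A"
  shows "\<exists>u d. eigenbasis n A u d"
proof -
  obtain P d where sim: "similar_mat_wit A (diagonal n d) P (transpose_mat P)"
    using spectral_theorem[OF assms] by blast
  note w = similar_mat_witD2[OF A sim]
  define u where "u = (\<lambda>k i. P $$ (i, k))"
  have P: "P \<in> carrier_mat n n" by (rule w)
  have h1: "(\<Sum>k<n. u k i * u k j) = (if i = j then 1 else 0)" if "i < n" "j < n" for i j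
    using arg_cong[OF w(1), of "\<lambda>M. M $$ (i, j)"] that P
    by (simp add: u_def scalar_prod_def lessThan_atLeast0)
  have h2: "(\<Sum>k<n. u i k * u j k) = (if i = j then 1 else 0)" if "i < n" "j < n" for i j
    using arg_cong[OF w(2), of "\<lambda>M. M $$ (i, j)"] that P
    by (simp add: u_def scalar_prod_def lessThan_atLeast0)
  have h3: "A $$ (i, j) = (\<Sum>k<n. d k * u k i * u k j)" if ij: "i < n" "j < n" for i j
  proof -
    have PD: "(P * diagonal n d) $$ (i, k) = P $$ (i, k) * d k" if "k < n" for k
      using that ij P by (simp add: scalar_prod_def lessThan_atLeast0 if_distrib cong: if_cong)
    have "A $$ (i, j) = (\<Sum>k<n. (P * diagonal n d) $$ (i, k) * P $$ (j, k))"
      by (subst w(3)) (use ij P in \<open>simp add: scalar_prod_def lessThan_atLeast0 row_def\<close>)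
    also have "\<dots> = (\<Sum>k<n. d k * u k i * u k j)"
      by (intro sum.cong refl) (simp add: PD u_def mult.commute)
    finally show ?thesis .
  qed
  have h4: "char_poly A = (\<Prod>a\<leftarrow>map d [0..<n]. [:- a, 1:])"
  proof -
    have "char_poly A = char_poly (diagonal n d)"
      using sim by (intro char_poly_similar) (auto simp: similar_mat_def)
    also have "\<dots> = (\<Prod>a\<leftarrow>diag_mat (diagonal n d). [:- a, 1:])"
      by (rule char_poly_upper_triangular) auto
    also have "diag_mat (diagonal n d) = map d [0..<n]"
      by (simp add: diag_mat_def)
    finally show ?thesis .
  qed
  have "eigenbasis n A u d"
    unfolding eigenbasis_def by (intro conjI allI impI h1 h2 h3 h4)
  then show ?thesis by blast
qed

section \<open>Eigenvalues in decreasing order\<close>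

lemma prod_list_linear_nonzero: "(\<Prod>a\<leftarrow>es. [:- a, 1:]) \<noteq> (0 :: real poly)"
  unfolding prod_list_zero_iff by (simp only: set_map) auto

lemma proots_linear_mult:
  "p \<noteq> 0 \<Longrightarrow> proots ([:- a, 1:] * p) = add_mset a (proots (p :: real poly))"
  by (subst proots_mult) (simp_all del: mult_pCons_left)

lemma proots_prod_list_linear:
  "proots (\<Prod>a\<leftarrow>es. [:- a, 1:]) = mset (es :: real list)"
proof (induction es)
  case (Cons a es)
  show ?case
    by (simp only: list.map prod_list.Cons proots_linear_mult[OF prod_list_linear_nonzero]
        Cons.IH mset.simps)
qed simp

text \<open>\<open>eigval\<close> reads the multiset of roots as a descending list, which is a
  rearrangement of \<open>d\<close>. \<open>Suc\<close> appears because eigenvalues are counted from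
  1 and list positions from 0.\<close>

lemma eigval_enumerates:
  assumes cp: "char_poly A = (\<Prod>a\<leftarrow>map d [0..<n]. [:- a, 1:])"
  shows "\<exists>p. bij_betw p {..<n} {..<n} \<and> (\<forall>i<n. d i = eigval A (Suc (p i)))"
    and "\<lbrakk>i \<le> j; j < n\<rbrakk> \<Longrightarrow> eigval A (Suc j) \<le> eigval A (Suc i)"
proof -
  define es where "es = rev (sort (map d [0..<n]))"
  have len: "length es = n" by (simp add: es_def)
  have eig: "eigval A (Suc k) = es ! k" for k
    by (simp only: eigval_def cp proots_prod_list_linear sorted_list_of_multiset_mset es_def diff_Suc_1)
  have "mset (map d [0..<n]) = mset es" by (simp add: es_def)
  then obtain p where p: "p permutes {..<length es}" "permute_list p es = map d [0..<n]"
    by (rule mset_eq_permutation)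
  have "bij_betw p {..<n} {..<n}" using p len permutes_imp_bij by auto
  moreover have "d i = eigval A (Suc (p i))" if "i < n" for i
  proof -
    have "d i = permute_list p es ! i" using p that by simp
    also have "\<dots> = es ! p i" using p that len by (intro permute_list_nth) auto
    finally show ?thesis by (simp add: eig)
  qed
  ultimately show "\<exists>p. bij_betw p {..<n} {..<n} \<and> (\<forall>i<n. d i = eigval A (Suc (p i)))" by blast
  show "eigval A (Suc j) \<le> eigval A (Suc i)" if "i \<le> j" "j < n"
    using sorted_nth_mono[OF sorted_sort[of "map d [0..<n]"], of "n - Suc j" "n - Suc i"] that
    by (simp add: eig es_def rev_nth)
qed

text \<open>For the second bound: only one index can occupy the top position of the ordering, so of
  two distinct indices at least one sits at the second position or later.\<close>

lemma eigval_bounds: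
  assumes cp: "char_poly A = (\<Prod>a\<leftarrow>map d [0..<n]. [:- a, 1:])" and n: "2 \<le> n"
  shows eigval_last_le: "i < n \<Longrightarrow> eigval A n \<le> d i"
    and le_eigval_2: "\<lbrakk>i < n; j < n; i \<noteq> j\<rbrakk> \<Longrightarrow> d i \<le> eigval A 2 \<or> d j \<le> eigval A 2"
proof -
  obtain p where p: "bij_betw p {..<n} {..<n}" "\<forall>i<n. d i = eigval A (Suc (p i))"
    using eigval_enumerates(1)[OF cp] by blast
  note mono = eigval_enumerates(2)[OF cp]
  have pn: "p i < n" if "i < n" for i using p(1) that bij_betwE by fastforce
  show "eigval A n \<le> d i" if "i < n"
    using mono[of "p i" "n - 1"] pn[OF that] p(2) that n by simp
  show "d i \<le> eigval A 2 \<or> d j \<le> eigval A 2" if ij: "i < n" "j < n" "i \<noteq> j"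
  proof -
    have "p i \<noteq> p j" using p(1) ij by (auto simp: bij_betw_def inj_on_def)
    then consider "1 \<le> p i" | "1 \<le> p j" by linarith
    then show ?thesis
    proof cases
      case 1
      then show ?thesis using mono[OF 1 pn] p(2) ij by (simp add: numeral_2_eq_2)
    next
      case 2
      then show ?thesis using mono[OF 2 pn] p(2) ij by (simp add: numeral_2_eq_2)
    qed
  qed
qed

section \<open>The mixing operator on stacked vectors\<close>

definition mix :: "nat \<Rightarrow> real mat \<Rightarrow> (nat \<Rightarrow> 'a::real_vector) \<Rightarrow> nat \<Rightarrow> 'a" where
  "mix n W x i = (\<Sum>j<n. W $$ (i, j) *\<^sub>R x j)"

locale mixing =
  fixes n :: nat and W :: "real mat"
  assumes W_carrier: "W \<in> carrier_mat n n"
    and W_sym: "transpose_mat W = W"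
    and W_stochastic: "doubly_stochastic n W"
    and W_beta: "beta n W < 1"
    and n_pos: "1 \<le> n"
begin

lemma W_symD: "i < n \<Longrightarrow> j < n \<Longrightarrow> W $$ (i, j) = W $$ (j, i)"
  using W_sym W_carrier by (metis carrier_matD index_transpose_mat(1))

lemma W_nonneg: "i < n \<Longrightarrow> j < n \<Longrightarrow> 0 \<le> W $$ (i, j)"
  and W_row: "i < n \<Longrightarrow> (\<Sum>j<n. W $$ (i, j)) = 1"
  and W_col: "j < n \<Longrightarrow> (\<Sum>i<n. W $$ (i, j)) = 1"
  using W_stochastic by (auto simp: doubly_stochastic_def)

text \<open>For \<open>n = 1\<close> the matrix is the scalar 1, so \<open>beta\<close> would be at
  least 1. The bound makes \<open>eigval W 2\<close> a genuine entry of the list of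
  eigenvalues.\<close>

lemma n_ge_2: "2 \<le> n"
proof (rule ccontr)
  assume "\<not> 2 \<le> n"
  then have n1: "n = 1" using n_pos by simp
  obtain u d where basis: "eigenbasis n W u d"
    using eigenbasis_exists[OF W_carrier W_sym] by blast
  have u: "(\<Sum>k<n. u k i * u k j) = (if i = j then 1 else 0)"
    and u': "(\<Sum>k<n. u i k * u j k) = (if i = j then 1 else 0)"
    and Wd: "W $$ (i, j) = (\<Sum>k<n. d k * u k i * u k j)" if "i < n" "j < n" for i j
    using basis that unfolding eigenbasis_def by blast+
  have cp: "char_poly W = (\<Prod>a\<leftarrow>map d [0..<n]. [:- a, 1:])"
    using basis unfolding eigenbasis_def by blast
  have "W $$ (0, 0) = 1" using W_row[of 0] n1 by simp
  moreover have "W $$ (0, 0) = d 0 * (u 0 0 * u 0 0)" using Wd[of 0 0] n1 by simp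
  moreover have "u 0 0 * u 0 0 = 1" using u[of 0 0] n1 by simp
  ultimately have "d 0 = 1" by simp
  moreover obtain p where p: "bij_betw p {..<n} {..<n}" "\<forall>i<n. d i = eigval W (Suc (p i))"
    using eigval_enumerates(1)[OF cp] by blast
  moreover have "p 0 < n" using bij_betwE[OF p(1)] n1 by simp
  ultimately have "eigval W n = 1" using n1 by simp
  then show False using W_beta by (auto simp: beta_def)
qed

text \<open>Diagonalizes \<open>mix\<close>: \<open>c k\<close> is the coordinate of
  \<open>x\<close> along the \<open>k\<close>-th eigenvector, an element of \<open>'a\<close>
  because \<open>W\<close> acts on agent indices only. The last conjunct removes the consensus
  direction from vectors summing to zero.\<close>

lemma spectrum:
  fixes x :: "nat \<Rightarrow> 'a::real_inner"
  shows "\<exists>d c. (\<forall>k<n. eigval W n \<le> d k) \<and>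
    (\<Sum>k<n. (norm (c k :: 'a))\<^sup>2) = (\<Sum>i<n. (norm (x i))\<^sup>2) \<and>
    (\<Sum>i<n. inner (x i) (mix n W x i)) = (\<Sum>k<n. d k * (norm (c k))\<^sup>2) \<and>
    (\<Sum>i<n. (norm (mix n W x i))\<^sup>2) = (\<Sum>k<n. (d k * norm (c k))\<^sup>2) \<and>
    ((\<Sum>i<n. x i) = 0 \<longrightarrow> (\<forall>k<n. c k \<noteq> 0 \<longrightarrow> d k \<le> eigval W 2))"
proof -
  obtain u d where basis: "eigenbasis n W u d"
    using eigenbasis_exists[OF W_carrier W_sym] by blast
  have u: "(\<Sum>k<n. u k i * u k j) = (if i = j then 1 else 0)"
    and u': "(\<Sum>k<n. u i k * u j k) = (if i = j then 1 else 0)"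
    and Wd: "W $$ (i, j) = (\<Sum>k<n. d k * u k i * u k j)" if "i < n" "j < n" for i j
    using basis that unfolding eigenbasis_def by blast+
  have cp: "char_poly W = (\<Prod>a\<leftarrow>map d [0..<n]. [:- a, 1:])"
    using basis unfolding eigenbasis_def by blast
  have uW: "(\<Sum>i<n. u k i * W $$ (i, j)) = d k * u k j" if kj: "k < n" "j < n" for k j
  proof -
    have "(\<Sum>i<n. u k i * W $$ (i, j)) = (\<Sum>i<n. \<Sum>m<n. (d m * u m j) * (u k i * u m i))"
      using kj by (intro sum.cong refl) (simp add: Wd sum_distrib_left mult_ac)
    also have "\<dots> = (\<Sum>m<n. (d m * u m j) * (\<Sum>i<n. u k i * u m i))"
      by (subst sum.swap) (simp add: sum_distrib_left)
    also have "\<dots> = (\<Sum>m<n. if m = k then d k * u k j else 0)"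
      using kj by (intro sum.cong refl) (simp add: u')
    finally show ?thesis using kj by simp
  qed
  define co where "co = (\<lambda>k (z :: nat \<Rightarrow> 'a). \<Sum>i<n. u k i *\<^sub>R z i)"
  have parseval: "(\<Sum>k<n. inner (co k y) (co k z)) = (\<Sum>i<n. inner (y i) (z i))" for y z
  proof -
    have "(\<Sum>k<n. inner (co k y) (co k z))
        = (\<Sum>k<n. \<Sum>i<n. \<Sum>j<n. (u k i * u k j) * inner (y i) (z j))"
      by (simp add: co_def inner_sum_left inner_sum_right sum_distrib_left mult.assoc)
        (rule sum.cong[OF refl], subst sum.swap, simp add: mult.left_commute)
    also have "\<dots> = (\<Sum>i<n. \<Sum>j<n. (\<Sum>k<n. u k i * u k j) * inner (y i) (z j))"
      by (subst sum.swap, rule sum.cong[OF refl], subst sum.swap) (simp add: sum_distrib_right)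
    also have "\<dots> = (\<Sum>i<n. \<Sum>j<n. if j = i then inner (y i) (z i) else 0)"
      by (intro sum.cong refl) (simp add: u)
    finally show ?thesis by simp
  qed
  have co_mix: "co k (mix n W x) = d k *\<^sub>R co k x" if "k < n" for k
  proof -
    have "co k (mix n W x) = (\<Sum>j<n. (\<Sum>i<n. u k i * W $$ (i, j)) *\<^sub>R x j)"
      by (simp add: co_def mix_def scaleR_sum_right scaleR_sum_left) (rule sum.swap)
    also have "\<dots> = d k *\<^sub>R co k x"
      using that by (simp add: uW co_def scaleR_sum_right)
    finally show ?thesis .
  qed
  \<comment> \<open>At most one eigenvalue exceeds \<open>eigval W 2\<close>. Its eigenvector is then constant, because all
    other eigenvectors are orthogonal to the constant vector, which has eigenvalue 1.\<close>
  have top: "d k \<le> eigval W 2" if x0: "(\<Sum>i<n. x i) = 0" and k: "k < n" "co k x \<noteq> 0" for k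
  proof (rule ccontr)
    assume large: "\<not> d k \<le> eigval W 2"
    define s where "s = (\<lambda>m. \<Sum>i<n. u m i)"
    have s_eig: "s m = d m * s m" if "m < n" for m
    proof -
      have "s m = (\<Sum>i<n. u m i * (\<Sum>j<n. W $$ (i, j)))" by (simp add: s_def W_row)
      also have "\<dots> = (\<Sum>j<n. \<Sum>i<n. u m i * W $$ (i, j))"
        by (simp add: sum_distrib_left) (rule sum.swap)
      finally show ?thesis using that by (simp add: uW s_def sum_distrib_left[symmetric])
    qed
    have s0: "s m = 0" if m: "m < n" "m \<noteq> k" for m
    proof -
      have "d m < 1"
        using le_eigval_2[OF cp n_ge_2 \<open>k < n\<close> \<open>m < n\<close>] m large W_beta by (auto simp: beta_def)
      then show ?thesis using s_eig[OF m(1)] by auto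
    qed
    \<comment> \<open>The all-ones vector is expanded in the basis with coefficients
      \<open>s m\<close>; by \<open>s0\<close> only the \<open>k\<close>-th term survives.\<close>
    have one: "s k * u k i = 1" if i: "i < n" for i
    proof -
      have "(\<Sum>m<n. s m * u m i) = (\<Sum>j<n. \<Sum>m<n. u m j * u m i)"
        by (simp add: s_def sum_distrib_right) (rule sum.swap)
      also have "\<dots> = 1" using i by (simp add: u)
      finally have "(\<Sum>m<n. s m * u m i) = 1" .
      moreover have "(\<Sum>m<n. s m * u m i) = (\<Sum>m<n. if m = k then s k * u k i else 0)"
        by (intro sum.cong refl) (auto simp: s0)
      ultimately show ?thesis using k by simp
    qed
    have "s k *\<^sub>R co k x = (\<Sum>i<n. x i)" by (simp add: co_def scaleR_sum_right one)
    moreover have "s k \<noteq> 0" using one[OF k(1)] by auto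
    ultimately show False using x0 k by simp
  qed
  have h1: "\<forall>k<n. eigval W n \<le> d k" using eigval_last_le[OF cp n_ge_2] by blast
  have h2: "(\<Sum>k<n. (norm (co k x))\<^sup>2) = (\<Sum>i<n. (norm (x i))\<^sup>2)"
    using parseval[of x x] by (simp add: power2_norm_eq_inner)
  have h3: "(\<Sum>i<n. inner (x i) (mix n W x i)) = (\<Sum>k<n. d k * (norm (co k x))\<^sup>2)"
    unfolding parseval[of x "mix n W x", symmetric] by (simp add: power2_norm_eq_inner co_mix)
  have h4: "(\<Sum>i<n. (norm (mix n W x i))\<^sup>2) = (\<Sum>k<n. (d k * norm (co k x))\<^sup>2)"
    unfolding power2_norm_eq_inner parseval[of "mix n W x" "mix n W x", symmetric]
    by (simp add: co_mix power_mult_distrib power2_norm_eq_inner power2_eq_square[of "d _"] mult.assoc)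
  have h5: "(\<Sum>i<n. x i) = 0 \<longrightarrow> (\<forall>k<n. co k x \<noteq> 0 \<longrightarrow> d k \<le> eigval W 2)"
    using top by blast
  show ?thesis
    by (rule exI[of _ d], rule exI[of _ "\<lambda>k. co k x"]) (intro conjI h1 h2 h3 h4 h5)
qed

lemma mix_inner_ge:
  fixes x :: "nat \<Rightarrow> 'a::real_inner"
  shows "eigval W n * (\<Sum>i<n. (norm (x i))\<^sup>2) \<le> (\<Sum>i<n. inner (x i) (mix n W x i))"
  using spectrum[of x]
proof (elim exE conjE)
  fix d and c :: "nat \<Rightarrow> 'a"
  assume d: "\<forall>k<n. eigval W n \<le> d k"
    and c: "(\<Sum>k<n. (norm (c k))\<^sup>2) = (\<Sum>i<n. (norm (x i))\<^sup>2)"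
    and q: "(\<Sum>i<n. inner (x i) (mix n W x i)) = (\<Sum>k<n. d k * (norm (c k))\<^sup>2)"
  show ?thesis
    unfolding q c[symmetric] sum_distrib_left
    by (intro sum_mono mult_right_mono) (use d in auto)
qed

text \<open>Without a consensus component only eigenvalues between \<open>eigval W n\<close> and
  \<open>eigval W 2\<close> contribute, and \<open>beta\<close> is the larger absolute value of
  these two endpoints.\<close>

lemma mix_contracts:
  fixes x :: "nat \<Rightarrow> 'a::real_inner"
  assumes "(\<Sum>i<n. x i) = 0"
  shows "(\<Sum>i<n. (norm (mix n W x i))\<^sup>2) \<le> (beta n W)\<^sup>2 * (\<Sum>i<n. (norm (x i))\<^sup>2)"
  using spectrum[of x]
proof (elim exE conjE)
  fix d and c :: "nat \<Rightarrow> 'a"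
  assume d: "\<forall>k<n. eigval W n \<le> d k"
    and c: "(\<Sum>k<n. (norm (c k))\<^sup>2) = (\<Sum>i<n. (norm (x i))\<^sup>2)"
    and q: "(\<Sum>i<n. (norm (mix n W x i))\<^sup>2) = (\<Sum>k<n. (d k * norm (c k))\<^sup>2)"
    and top: "(\<Sum>i<n. x i) = 0 \<longrightarrow> (\<forall>k<n. c k \<noteq> 0 \<longrightarrow> d k \<le> eigval W 2)"
  have "(d k * norm (c k))\<^sup>2 \<le> (beta n W)\<^sup>2 * (norm (c k))\<^sup>2" if k: "k < n" for k
  proof (cases "c k = 0")
    case False
    then have "eigval W n \<le> d k" "d k \<le> eigval W 2" using d top assms k by blast+
    then have "\<bar>d k\<bar> \<le> \<bar>beta n W\<bar>" unfolding beta_def by linarith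
    then have "(d k)\<^sup>2 \<le> (beta n W)\<^sup>2" by (simp add: abs_le_square_iff)
    then show ?thesis by (simp add: power_mult_distrib mult_right_mono)
  qed simp
  then show ?thesis
    unfolding q c[symmetric] sum_distrib_left by (intro sum_mono) auto
qed

end

section \<open>Smooth convex functions\<close>

text \<open>Two gradients represent the same derivative; evaluating it at \<open>D' - D\<close>
  forces them to agree, which justifies the definite description in \<open>grad\<close>.\<close>

lemma grad_eq:
  assumes "GDERIV g x :> D"
  shows "grad g x = D"
  unfolding grad_def
proof (rule the_equality)
  show "GDERIV g x :> D" by (rule assms)
next
  fix D' assume "GDERIV g x :> D'"
  then have "(\<lambda>h. inner h D') = (\<lambda>h. inner h D)"
    using assms unfolding gderiv_def by (rule has_derivative_unique)
  then have "inner (D' - D) D' = inner (D' - D) D"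
    by (rule fun_cong)
  then have "inner (D' - D) (D' - D) = 0"
    by (simp only: inner_diff_right diff_self)
  then show "D' = D" by simp
qed

text \<open>Riesz representation in coordinates: the gradient collects the values of the derivative
  on the orthonormal basis.\<close>

lemma GDERIV_grad:
  fixes g :: "'a::euclidean_space \<Rightarrow> real"
  assumes "g differentiable (at x)"
  shows "GDERIV g x :> grad g x"
proof -
  obtain g' where g': "(g has_derivative g') (at x)"
    using assms by (auto simp: differentiable_def)
  then interpret linear g' by (rule has_derivative_linear)
  define D where "D = (\<Sum>b\<in>Basis. g' b *\<^sub>R b)"
  have "g' h = inner h D" for h
  proof -
    have "g' h = g' (\<Sum>b\<in>Basis. inner h b *\<^sub>R b)" by (simp add: euclidean_representation)
    also have "\<dots> = inner h D" by (simp add: sum scale inner_sum_right D_def mult.commute)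
    finally show ?thesis .
  qed
  then have D: "GDERIV g x :> D"
    using g' unfolding gderiv_def by (metis (no_types) ext)
  then show ?thesis by (simp add: grad_eq)
qed

definition convex_smooth :: "real \<Rightarrow> ('a::euclidean_space \<Rightarrow> real) \<Rightarrow> bool" where
  "convex_smooth M g \<longleftrightarrow> 0 < M \<and> convex_on UNIV g \<and> (\<forall>x. g differentiable (at x)) \<and>
     (\<forall>x y. norm (grad g x - grad g y) \<le> M * norm (x - y))"

context
  fixes g :: "'a::euclidean_space \<Rightarrow> real" and M :: real
  assumes g: "convex_smooth M g"
begin

lemma M_pos: "0 < M"
  using g by (simp add: convex_smooth_def)

lemma grad_lipschitz: "norm (grad g x - grad g y) \<le> M * norm (x - y)"
  using g by (simp add: convex_smooth_def)

lemma DERIV_along_line: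
  "((\<lambda>t. g (x + t *\<^sub>R d)) has_real_derivative inner (grad g (x + t *\<^sub>R d)) d) (at t)"
proof -
  have "((\<lambda>t. x + t *\<^sub>R d) has_derivative (\<lambda>s. s *\<^sub>R d)) (at t)"
    by (auto intro!: derivative_eq_intros)
  moreover have "(g has_derivative (\<lambda>h. inner h (grad g (x + t *\<^sub>R d)))) (at (x + t *\<^sub>R d))"
    using GDERIV_grad g by (auto simp: gderiv_def convex_smooth_def)
  ultimately have "((\<lambda>t. g (x + t *\<^sub>R d)) has_derivative
      (\<lambda>s. inner (s *\<^sub>R d) (grad g (x + t *\<^sub>R d)))) (at t)"
    by (rule has_derivative_compose)
  moreover have "(\<lambda>s. inner (s *\<^sub>R d) (grad g (x + t *\<^sub>R d))) = (*) (inner (grad g (x + t *\<^sub>R d)) d)"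
    by (simp add: fun_eq_iff inner_commute)
  ultimately show ?thesis
    by (simp only: has_field_derivative_def)
qed

text \<open>Restriction to the line through \<open>x\<close> and \<open>y\<close> reduces the claim
  to the tangent inequality for convex functions of one real variable.\<close>

lemma convex_above_tangent: "g x + inner (grad g x) (y - x) \<le> g y"
proof -
  let ?\<phi> = "\<lambda>t. g (x + t *\<^sub>R (y - x))"
  have "convex_on UNIV ?\<phi>"
  proof (rule convex_onI)
    fix t a b :: real assume t: "0 < t" "t < 1"
    have "x + ((1 - t) *\<^sub>R a + t *\<^sub>R b) *\<^sub>R (y - x)
        = (1 - t) *\<^sub>R (x + a *\<^sub>R (y - x)) + t *\<^sub>R (x + b *\<^sub>R (y - x))"
      by (simp add: algebra_simps)
    then show "?\<phi> ((1 - t) *\<^sub>R a + t *\<^sub>R b) \<le> (1 - t) * ?\<phi> a + t * ?\<phi> b"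
      using convex_onD[of UNIV g t "x + a *\<^sub>R (y - x)" "x + b *\<^sub>R (y - x)"] g t
      by (simp add: convex_smooth_def)
  qed simp
  from convex_on_imp_above_tangent[OF this, of 0 1 "inner (grad g x) (y - x)"]
    DERIV_along_line[of x "y - x" 0]
  show ?thesis by simp
qed

text \<open>\<open>?\<psi>\<close> is \<open>g\<close> along the segment minus the linear and
  quadratic terms of the bound. Cauchy-Schwarz and the Lipschitz bound make its derivative
  nonpositive, and comparing the endpoints gives the claim.\<close>

lemma descent_lemma: "g (x + d) \<le> g x + inner (grad g x) d + M / 2 * (norm d)\<^sup>2"
proof -
  let ?\<psi> = "\<lambda>t. g (x + t *\<^sub>R d) - t * inner (grad g x) d - M / 2 * (norm d)\<^sup>2 * t\<^sup>2"
  have "?\<psi> 1 \<le> ?\<psi> 0"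
  proof (rule DERIV_nonpos_imp_nonincreasing[of 0 1 ?\<psi>])
    fix t :: real assume t: "0 \<le> t" "t \<le> 1"
    let ?D = "inner (grad g (x + t *\<^sub>R d)) d - inner (grad g x) d - M * (norm d)\<^sup>2 * t"
    have "DERIV ?\<psi> t :> ?D"
      by (rule derivative_eq_intros DERIV_along_line refl)+ simp
    moreover have "?D \<le> 0"
    proof -
      have "inner (grad g (x + t *\<^sub>R d)) d - inner (grad g x) d
          \<le> norm (grad g (x + t *\<^sub>R d) - grad g x) * norm d"
        by (metis inner_diff_left norm_cauchy_schwarz)
      also have "\<dots> \<le> (M * norm (x + t *\<^sub>R d - x)) * norm d"
        by (rule mult_right_mono[OF grad_lipschitz norm_ge_zero])
      also have "\<dots> = M * (norm d)\<^sup>2 * t" using t by (simp add: power2_eq_square)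
      finally show ?thesis by simp
    qed
    ultimately show "\<exists>D. DERIV ?\<psi> t :> D \<and> D \<le> 0" by blast
  qed simp
  then show ?thesis by simp
qed

text \<open>The value \<open>g (y + d)\<close> lies above the tangent at \<open>x\<close> and below
  the quadratic model at \<open>y\<close>. The shift \<open>d\<close> minimizes the model minus the
  tangent, which is where the squared gradient difference comes from.\<close>

lemma above_tangent_quadratic:
  "g x + inner (grad g x) (y - x) + (norm (grad g y - grad g x))\<^sup>2 / (2 * M) \<le> g y"
proof -
  define e where "e = grad g y - grad g x"
  define d where "d = - (1 / M) *\<^sub>R e"
  have nd: "M / 2 * (norm d)\<^sup>2 = (norm e)\<^sup>2 / (2 * M)"
    using M_pos by (simp add: d_def power2_eq_square field_simps)
  have ed: "inner e d = - (2 * ((norm e)\<^sup>2 / (2 * M)))"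
    by (simp add: d_def power2_norm_eq_inner)
  have "g x + inner (grad g x) (y + d - x) \<le> g (y + d)" by (rule convex_above_tangent)
  also have "\<dots> \<le> g y + inner (grad g y) d + M / 2 * (norm d)\<^sup>2" by (rule descent_lemma)
  finally have "g x + inner (grad g x) (y - x) \<le> g y + inner e d + M / 2 * (norm d)\<^sup>2"
    by (simp add: e_def inner_diff_right inner_diff_left inner_add_right)
  then show ?thesis unfolding nd ed e_def[symmetric] by linarith
qed

text \<open>Baillon-Haddad: adding the quadratic lower bounds for \<open>(x, y)\<close> and
  \<open>(y, x)\<close> cancels the function values.\<close>

lemma cocoercive: "(norm (grad g x - grad g y))\<^sup>2 \<le> M * inner (grad g x - grad g y) (x - y)"
proof -
  have "(norm (grad g x - grad g y))\<^sup>2 / (2 * M) + (norm (grad g x - grad g y))\<^sup>2 / (2 * M)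
      \<le> inner (grad g x - grad g y) (x - y)"
    using above_tangent_quadratic[of x y] above_tangent_quadratic[of y x]
    by (simp add: norm_minus_commute inner_diff_right inner_diff_left)
  then show ?thesis using M_pos by (simp add: field_simps)
qed

text \<open>A gradient step of length \<open>1 / M\<close> lowers \<open>g\<close> by at least
  \<open>|grad g x|^2 / (2 M)\<close>, and the result cannot fall below \<open>g xo\<close>.\<close>

lemma norm_grad_squared_le:
  assumes "minimizer g xo"
  shows "(norm (grad g x))\<^sup>2 \<le> 2 * M * (g x - g xo)"
proof -
  let ?d = "- (1 / M) *\<^sub>R grad g x"
  have "g xo \<le> g (x + ?d)" using assms by (simp add: is_arg_min_linorder)
  also have "\<dots> \<le> g x + inner (grad g x) ?d + M / 2 * (norm ?d)\<^sup>2" by (rule descent_lemma)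
  also have "\<dots> = g x - (norm (grad g x))\<^sup>2 / (2 * M)"
    using M_pos by (simp add: power2_norm_eq_inner[symmetric] power2_eq_square field_simps)
  finally show ?thesis using M_pos by (simp add: field_simps)
qed

end

section \<open>Descent on the penalized objective\<close>

text \<open>The inner product of stacked vectors; only semidefinite on functions, since indices from
  \<open>n\<close> on do not count.\<close>

definition sip :: "nat \<Rightarrow> (nat \<Rightarrow> 'a::real_inner) \<Rightarrow> (nat \<Rightarrow> 'a) \<Rightarrow> real" where
  "sip n x y = (\<Sum>i<n. inner (x i) (y i))"

lemma sip_commute: "sip n x y = sip n y x"
  by (simp add: sip_def inner_commute)

lemma sip_self: "sip n x x = (\<Sum>i<n. (norm (x i))\<^sup>2)"
  by (simp add: sip_def power2_norm_eq_inner)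

lemma sip_nonneg: "0 \<le> sip n x x"
  by (simp add: sip_self sum_nonneg)

lemma sip_eq_0: "sip n x x = 0 \<Longrightarrow> i < n \<Longrightarrow> x i = 0"
  by (simp add: sip_self sum_nonneg_eq_0_iff)

lemma sip_add: "sip n (\<lambda>i. x i + y i) z = sip n x z + sip n y z"
  "sip n z (\<lambda>i. x i + y i) = sip n z x + sip n z y"
  by (simp_all add: sip_def inner_add_left inner_add_right sum.distrib)

lemma sip_diff: "sip n (\<lambda>i. x i - y i) z = sip n x z - sip n y z"
  "sip n z (\<lambda>i. x i - y i) = sip n z x - sip n z y"
  by (simp_all add: sip_def inner_diff_left inner_diff_right sum_subtractf)

lemma sip_scaleR: "sip n (\<lambda>i. c *\<^sub>R x i) z = c * sip n x z"
  "sip n z (\<lambda>i. c *\<^sub>R x i) = c * sip n z x"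
  by (simp_all add: sip_def sum_distrib_left)

lemma mix_add: "mix n W (\<lambda>i. x i + y i) = (\<lambda>i. mix n W x i + mix n W y i)"
  by (simp add: fun_eq_iff mix_def scaleR_add_right sum.distrib)

lemma mix_diff: "mix n W (\<lambda>i. x i - y i) = (\<lambda>i. mix n W x i - mix n W y i)"
  by (simp add: fun_eq_iff mix_def scaleR_diff_right sum_subtractf)

lemma mix_scaleR: "mix n W (\<lambda>i. c *\<^sub>R x i) = (\<lambda>i. c *\<^sub>R mix n W x i)"
  by (simp add: fun_eq_iff mix_def scaleR_sum_right mult.commute)

text \<open>The operator \<open>I - W\<close>, a weighted graph Laplacian. For symmetric
  \<open>W\<close> it is the gradient of the consensus penalty
  \<open>1/2 * sip n x (lap n W x)\<close> contained in \<open>xi\<close>.\<close>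

definition lap :: "nat \<Rightarrow> real mat \<Rightarrow> (nat \<Rightarrow> 'a::real_vector) \<Rightarrow> nat \<Rightarrow> 'a" where
  "lap n W x i = x i - mix n W x i"

lemma lap_add: "lap n W (\<lambda>i. x i + y i) = (\<lambda>i. lap n W x i + lap n W y i)"
  by (simp add: lap_def mix_add fun_eq_iff)

lemma lap_diff: "lap n W (\<lambda>i. x i - y i) = (\<lambda>i. lap n W x i - lap n W y i)"
  by (simp add: lap_def mix_diff fun_eq_iff)

lemma lap_scaleR: "lap n W (\<lambda>i. c *\<^sub>R x i) = (\<lambda>i. c *\<^sub>R lap n W x i)"
  by (simp add: lap_def mix_scaleR fun_eq_iff scaleR_diff_right)

text \<open>The two sides differ by \<open>|t a - s b|^2 / (s t)\<close>. The weights allow two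
  cocoercive operators with constants \<open>s\<close> and \<open>t\<close> to be added into one
  with constant \<open>s + t\<close>.\<close>

lemma norm_add_squared_weighted:
  fixes a b :: "'a::real_inner"
  assumes "0 < s" "0 < t"
  shows "(norm (a + b))\<^sup>2 \<le> (s + t) * ((norm a)\<^sup>2 / s + (norm b)\<^sup>2 / t)"
proof -
  have 1: "(norm (a + b))\<^sup>2 = (norm a)\<^sup>2 + 2 * inner a b + (norm b)\<^sup>2"
    by (simp add: power2_norm_eq_inner inner_add_left inner_add_right inner_commute)
  have 2: "(norm (t *\<^sub>R a - s *\<^sub>R b))\<^sup>2
      = t\<^sup>2 * (norm a)\<^sup>2 - 2 * s * t * inner a b + s\<^sup>2 * (norm b)\<^sup>2"
    unfolding power2_norm_eq_inner
    by (simp add: inner_diff_left inner_diff_right inner_commute power2_eq_square)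
  have "0 \<le> (norm (t *\<^sub>R a - s *\<^sub>R b))\<^sup>2 / (s * t)" using assms by simp
  also have "\<dots> = (s + t) * ((norm a)\<^sup>2 / s + (norm b)\<^sup>2 / t) - (norm (a + b))\<^sup>2"
    using assms unfolding 1 2 by (simp add: field_simps power2_eq_square)
  finally show ?thesis by simp
qed

section \<open>Bounds on the Laplacian \<open>I - W\<close>\<close>

context mixing
begin

lemma eigval_n_less_1: "eigval W n < 1"
  using W_beta by (auto simp: beta_def)

lemma sip_mix: "sip n x (mix n W y) = sip n (mix n W x) y"
proof -
  have "sip n x (mix n W y) = (\<Sum>i<n. \<Sum>j<n. W $$ (i, j) * inner (x i) (y j))"
    by (simp add: sip_def mix_def inner_sum_right)
  also have "\<dots> = (\<Sum>j<n. \<Sum>i<n. W $$ (i, j) * inner (x i) (y j))" by (rule sum.swap)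
  also have "\<dots> = (\<Sum>j<n. \<Sum>i<n. W $$ (j, i) * inner (x i) (y j))"
    by (intro sum.cong refl) (simp add: W_symD)
  also have "\<dots> = sip n (mix n W x) y"
    by (simp add: sip_def mix_def inner_sum_left)
  finally show ?thesis .
qed

lemma sip_lap: "sip n x (lap n W y) = sip n (lap n W x) y"
  unfolding lap_def by (simp add: sip_diff sip_mix)

text \<open>Each cross term is at most the mean of two squared norms; as the weights are nonnegative
  and rows and columns sum to 1, \<open>sip n x (mix n W x)\<close> is at most
  \<open>sip n x x\<close>.\<close>

lemma sip_lap_nonneg: "0 \<le> sip n x (lap n W x)"
proof -
  have "sip n x (mix n W x) = (\<Sum>i<n. \<Sum>j<n. W $$ (i, j) * inner (x i) (x j))"
    by (simp add: sip_def mix_def inner_sum_right)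
  also have "\<dots> \<le> (\<Sum>i<n. \<Sum>j<n. W $$ (i, j) * (norm (x i))\<^sup>2 / 2 + W $$ (i, j) * (norm (x j))\<^sup>2 / 2)"
  proof (intro sum_mono)
    fix i j assume ij: "i \<in> {..<n}" "j \<in> {..<n}"
    have "2 * inner (x i) (x j) \<le> (norm (x i))\<^sup>2 + (norm (x j))\<^sup>2"
      using zero_le_power2[of "norm (x i - x j)"] unfolding power2_norm_eq_inner
      by (simp add: inner_diff_left inner_diff_right inner_commute)
    then have "W $$ (i, j) * inner (x i) (x j) \<le> W $$ (i, j) * (((norm (x i))\<^sup>2 + (norm (x j))\<^sup>2) / 2)"
      using ij W_nonneg by (intro mult_left_mono) auto
    then show "W $$ (i, j) * inner (x i) (x j)
        \<le> W $$ (i, j) * (norm (x i))\<^sup>2 / 2 + W $$ (i, j) * (norm (x j))\<^sup>2 / 2"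
      by (simp add: algebra_simps)
  qed
  also have "\<dots> = (\<Sum>i<n. (\<Sum>j<n. W $$ (i, j)) * (norm (x i))\<^sup>2 / 2)
      + (\<Sum>j<n. (\<Sum>i<n. W $$ (i, j)) * (norm (x j))\<^sup>2 / 2)"
    unfolding sum.distrib sum_distrib_right sum_divide_distrib
    by (subst (3) sum.swap) (rule refl)
  also have "\<dots> = sip n x x"
    by (simp add: W_row W_col sip_self flip: sum_divide_distrib)
  finally show ?thesis
    unfolding lap_def sip_diff by simp
qed

lemma sip_lap_le: "sip n x (lap n W x) \<le> (1 - eigval W n) * sip n x x"
  using mix_inner_ge[of x]
  unfolding lap_def sip_diff sip_self[symmetric] sip_def[symmetric] by (simp add: algebra_simps)

text \<open>A self-adjoint operator with \<open>0 \<le> A \<le> s\<close> satisfies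
  \<open>A^2 \<le> s * A\<close>: expand positivity at \<open>x - A x / s\<close> and bound the
  cubic term by \<open>A \<le> s\<close>.\<close>

lemma sip_lap_cocoercive: "sip n (lap n W x) (lap n W x) \<le> (1 - eigval W n) * sip n x (lap n W x)"
proof -
  define s where "s = 1 - eigval W n"
  have s: "0 < s" using eigval_n_less_1 by (simp add: s_def)
  define y where "y = lap n W x"
  have "0 \<le> sip n (\<lambda>i. x i - (1 / s) *\<^sub>R y i) (lap n W (\<lambda>i. x i - (1 / s) *\<^sub>R y i))"
    by (rule sip_lap_nonneg)
  also have "\<dots> = sip n x y - 2 / s * sip n y y + 1 / s * (1 / s * sip n y (lap n W y))"
    using sip_lap[of x y]
    by (simp add: lap_diff lap_scaleR sip_diff sip_scaleR sip_commute[of n y x]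
        algebra_simps flip: y_def)
  also have "1 / s * (1 / s * sip n y (lap n W y)) \<le> 1 / s * (1 / s * (s * sip n y y))"
    using sip_lap_le[of y] s unfolding s_def[symmetric] by (intro mult_left_mono) auto
  also have "\<dots> = 1 / s * sip n y y" using s by simp
  finally have "1 / s * sip n y y \<le> sip n x y" by (simp add: algebra_simps)
  then show ?thesis using s unfolding y_def s_def[symmetric] by (simp add: field_simps)
qed

end

section \<open>The iteration as unit-step gradient descent on \<open>xi\<close>\<close>

locale dgd_setting = mixing n W for n W +
  fixes f :: "nat \<Rightarrow> 'a::euclidean_space \<Rightarrow> real" and M \<alpha> :: real
  assumes f_smooth: "i < n \<Longrightarrow> convex_smooth M (f i)"
    and \<alpha>_pos: "0 < \<alpha>"
    and \<alpha>_le: "\<alpha> * M \<le> 1 + eigval W n"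
begin

lemma M_pos: "0 < M"
  using f_smooth[of 0] n_pos by (simp add: convex_smooth_def)

text \<open>The \<open>i\<close>-th block of the gradient of \<open>xi n f W \<alpha>\<close> at \<open>x\<close>.\<close>

definition resid :: "(nat \<Rightarrow> 'a) \<Rightarrow> nat \<Rightarrow> 'a" where
  "resid x i = lap n W x i + \<alpha> *\<^sub>R grad (f i) (x i)"

lemma dgd_Suc: "dgd n f W \<alpha> (Suc k) i = dgd n f W \<alpha> k i - resid (dgd n f W \<alpha> k) i"
  by (simp add: resid_def lap_def mix_def)

lemma xi_eq: "xi n f W \<alpha> x = 1 / 2 * sip n x (lap n W x) + \<alpha> * (\<Sum>i<n. f i (x i))"
proof -
  have "sip n x (mix n W x) = (\<Sum>i<n. \<Sum>j<n. W $$ (i, j) * inner (x i) (x j))"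
    by (simp add: sip_def mix_def inner_sum_right)
  then show ?thesis
    unfolding xi_def lap_def sip_diff sip_self
    by (simp add: sum.distrib sum_distrib_left[symmetric] sum_divide_distrib[symmetric] sip_self
        algebra_simps)
qed

text \<open>The penalty has curvature at most \<open>1 - eigval W n\<close> and the objectives add
  at most \<open>\<alpha> * M\<close>, in total at most 2 by the stepsize bound. Half of this is the
  coefficient 1 of \<open>sip n d d\<close>.\<close>

lemma xi_descent:
  "xi n f W \<alpha> (\<lambda>i. x i + d i) \<le> xi n f W \<alpha> x + sip n d (resid x) + sip n d d"
proof -
  have "(\<Sum>i<n. f i (x i + d i))
      \<le> (\<Sum>i<n. f i (x i) + inner (grad (f i) (x i)) (d i) + M / 2 * (norm (d i))\<^sup>2)"
    by (intro sum_mono descent_lemma f_smooth) simp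
  also have "\<dots> = (\<Sum>i<n. f i (x i)) + sip n d (\<lambda>i. grad (f i) (x i)) + M / 2 * sip n d d"
    by (simp add: sum.distrib sum_distrib_left sip_self) (simp add: sip_def inner_commute)
  finally have 1: "\<alpha> * (\<Sum>i<n. f i (x i + d i)) \<le> \<alpha> * (\<Sum>i<n. f i (x i))
      + \<alpha> * sip n d (\<lambda>i. grad (f i) (x i)) + \<alpha> * M / 2 * sip n d d"
    using mult_left_mono[OF _ less_imp_le[OF \<alpha>_pos]] by (fastforce simp: algebra_simps)
  have 2: "sip n (\<lambda>i. x i + d i) (lap n W (\<lambda>i. x i + d i))
      = sip n x (lap n W x) + 2 * sip n d (lap n W x) + sip n d (lap n W d)"
    using sip_lap[of x d] by (simp add: lap_add sip_add sip_commute[of n d "lap n W x"])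
  have 3: "sip n d (resid x) = sip n d (lap n W x) + \<alpha> * sip n d (\<lambda>i. grad (f i) (x i))"
    unfolding resid_def by (simp add: sip_add sip_scaleR)
  have "\<alpha> * M * sip n d d \<le> (1 + eigval W n) * sip n d d"
    by (rule mult_right_mono[OF \<alpha>_le sip_nonneg])
  then have "1 / 2 * sip n d (lap n W d) + \<alpha> * M / 2 * sip n d d \<le> sip n d d"
    using sip_lap_le[of d] by (simp add: algebra_simps)
  then show ?thesis unfolding xi_eq 2 3 using 1 by (simp add: add_divide_distrib)
qed

lemma minimizer_xi_stationary:
  assumes "minimizer (xi n f W \<alpha>) xt" "i < n"
  shows "resid xt i = 0"
proof -
  let ?r = "resid xt"
  \<comment> \<open>With step length 1/2 the bound on the change is \<open>- 1/2 + 1/4\<close> times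
    the squared residual, hence strictly negative unless the residual vanishes; a full step would
    give zero.\<close>
  have "xi n f W \<alpha> xt \<le> xi n f W \<alpha> (\<lambda>i. xt i + (- 1 / 2) *\<^sub>R ?r i)"
    using assms by (simp add: is_arg_min_linorder)
  also have "\<dots> \<le> xi n f W \<alpha> xt + sip n (\<lambda>i. (- 1 / 2) *\<^sub>R ?r i) ?r
      + sip n (\<lambda>i. (- 1 / 2) *\<^sub>R ?r i) (\<lambda>i. (- 1 / 2) *\<^sub>R ?r i)"
    by (rule xi_descent)
  finally have "sip n ?r ?r \<le> 0" by (simp only: sip_scaleR)
  then show ?thesis using sip_eq_0[of n ?r i] sip_nonneg[of n ?r] assms by simp
qed

text \<open>\<open>resid\<close> is the sum of two cocoercive maps, \<open>lap\<close> with constant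
  \<open>1 - eigval W n\<close> and the scaled gradients with constant \<open>\<alpha> * M\<close>.
  The constants add up to at most 2.\<close>

lemma resid_cocoercive:
  "sip n (\<lambda>i. resid x i - resid y i) (\<lambda>i. resid x i - resid y i)
     \<le> 2 * sip n (\<lambda>i. x i - y i) (\<lambda>i. resid x i - resid y i)"
proof -
  define d where "d = (\<lambda>i. x i - y i)"
  define a where "a = lap n W d"
  define b where "b = (\<lambda>i. \<alpha> *\<^sub>R (grad (f i) (x i) - grad (f i) (y i)))"
  define s where "s = 1 - eigval W n"
  define t where "t = \<alpha> * M"
  have st: "0 < s" "0 < t" "s + t \<le> 2"
    using eigval_n_less_1 \<alpha>_pos M_pos \<alpha>_le by (auto simp: s_def t_def)
  have r: "(\<lambda>i. resid x i - resid y i) = (\<lambda>i. a i + b i)"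
    by (simp add: fun_eq_iff resid_def a_def b_def d_def lap_diff algebra_simps)
  have a: "sip n a a / s \<le> sip n d a"
    using sip_lap_cocoercive[of d] st by (simp add: a_def s_def field_simps)
  have "sip n b b \<le> t * sip n d b"
    unfolding sip_self unfolding sip_def sum_distrib_left
  proof (rule sum_mono)
    fix i assume "i \<in> {..<n}"
    then have "(norm (grad (f i) (x i) - grad (f i) (y i)))\<^sup>2
        \<le> M * inner (grad (f i) (x i) - grad (f i) (y i)) (x i - y i)"
      by (intro cocoercive f_smooth) simp
    then have "\<alpha>\<^sup>2 * (norm (grad (f i) (x i) - grad (f i) (y i)))\<^sup>2
        \<le> \<alpha>\<^sup>2 * (M * inner (grad (f i) (x i) - grad (f i) (y i)) (x i - y i))"
      by (intro mult_left_mono) auto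
    then show "(norm (b i))\<^sup>2 \<le> t * inner (d i) (b i)"
      by (simp add: b_def d_def t_def power_mult_distrib power2_eq_square[of \<alpha>] inner_commute mult_ac)
  qed
  then have b: "sip n b b / t \<le> sip n d b" using st by (simp add: field_simps)
  have "sip n (\<lambda>i. a i + b i) (\<lambda>i. a i + b i)
      \<le> (\<Sum>i<n. (s + t) * ((norm (a i))\<^sup>2 / s + (norm (b i))\<^sup>2 / t))"
    unfolding sip_self by (intro sum_mono norm_add_squared_weighted st)
  also have "\<dots> = (s + t) * (sip n a a / s + sip n b b / t)"
    by (simp only: sip_self sum_distrib_left[symmetric] sum.distrib sum_divide_distrib)
  also have "\<dots> \<le> 2 * (sip n a a / s + sip n b b / t)"
    using st sip_nonneg[of n a] sip_nonneg[of n b] by (intro mult_right_mono add_nonneg_nonneg) auto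
  also have "\<dots> \<le> 2 * sip n d (\<lambda>i. a i + b i)"
    using a b by (simp add: sip_add)
  finally show ?thesis unfolding r d_def .
qed

text \<open>The update map \<open>x - resid x\<close> fixes \<open>y\<close>. When the square is
  expanded, the factor 2 in \<open>resid_cocoercive\<close> lets the cross term absorb the squared
  residual.\<close>

lemma nonexpansive:
  assumes "\<And>i. i < n \<Longrightarrow> resid y i = 0"
  shows "sip n (\<lambda>i. x i - resid x i - y i) (\<lambda>i. x i - resid x i - y i)
    \<le> sip n (\<lambda>i. x i - y i) (\<lambda>i. x i - y i)"
proof -
  define d where "d = (\<lambda>i. x i - y i)"
  define r where "r = (\<lambda>i. resid x i - resid y i)"
  have "sip n (\<lambda>i. x i - resid x i - y i) (\<lambda>i. x i - resid x i - y i)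
      = sip n (\<lambda>i. d i - r i) (\<lambda>i. d i - r i)"
    unfolding sip_def by (intro sum.cong refl) (simp add: d_def r_def assms algebra_simps)
  also have "\<dots> = sip n d d - 2 * sip n d r + sip n r r"
    by (simp add: sip_diff sip_commute[of n r d])
  also have "\<dots> \<le> sip n d d" using resid_cocoercive[of x y] by (simp add: d_def r_def)
  finally show ?thesis by (simp add: d_def)
qed

lemma dgd_distance_nonincreasing:
  assumes "minimizer (xi n f W \<alpha>) xt"
  shows "(\<Sum>i<n. (norm (dgd n f W \<alpha> k i - xt i))\<^sup>2) \<le> (\<Sum>i<n. (norm (dgd n f W \<alpha> 0 i - xt i))\<^sup>2)"
proof (induction k)
  case (Suc k)
  from order_trans[OF nonexpansive[OF minimizer_xi_stationary[OF assms], of "dgd n f W \<alpha> k"]] Suc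
  show ?case unfolding dgd_Suc sip_self by blast
qed simp

text \<open>For \<open>d = - resid\<close> the linear and quadratic terms of
  \<open>xi_descent\<close> cancel, so \<open>xi\<close> never increases. The penalty is nonnegative
  and vanishes at the zero start, so the bound passes to the objectives.\<close>

lemma sum_f_dgd_le: "(\<Sum>i<n. f i (dgd n f W \<alpha> k i)) \<le> (\<Sum>i<n. f i 0)"
proof -
  have "xi n f W \<alpha> (dgd n f W \<alpha> k) \<le> xi n f W \<alpha> (\<lambda>_. 0)"
  proof (induction k)
    case (Suc k)
    let ?x = "dgd n f W \<alpha> k"
    have "dgd n f W \<alpha> (Suc k) = (\<lambda>i. ?x i + (- 1) *\<^sub>R resid ?x i)"
      by (rule ext) (simp add: dgd_Suc del: dgd.simps)
    then have "xi n f W \<alpha> (dgd n f W \<alpha> (Suc k)) \<le> xi n f W \<alpha> ?x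
        + sip n (\<lambda>i. (- 1) *\<^sub>R resid ?x i) (resid ?x)
        + sip n (\<lambda>i. (- 1) *\<^sub>R resid ?x i) (\<lambda>i. (- 1) *\<^sub>R resid ?x i)"
      by (simp only: xi_descent)
    also have "\<dots> = xi n f W \<alpha> ?x" by (simp only: sip_scaleR)
    finally show ?case using Suc by simp
  qed simp
  also have "\<dots> = \<alpha> * (\<Sum>i<n. f i 0)" by (simp add: xi_eq sip_def)
  finally have "\<alpha> * (\<Sum>i<n. f i (dgd n f W \<alpha> k i)) \<le> \<alpha> * (\<Sum>i<n. f i 0)"
    using sip_lap_nonneg[of "dgd n f W \<alpha> k"] by (simp add: xi_eq)
  then show ?thesis using \<alpha>_pos by simp
qed

text \<open>With \<open>M = L_h n L\<close> the right-hand side is the square of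
  \<open>D_const\<close>.\<close>

lemma sum_grad_dgd_le:
  assumes "\<And>i. i < n \<Longrightarrow> minimizer (f i) (xo i)"
  shows "(\<Sum>i<n. (norm (grad (f i) (dgd n f W \<alpha> k i)))\<^sup>2)
    \<le> 2 * M * ((\<Sum>i<n. f i 0) - (\<Sum>i<n. f i (xo i)))"
proof -
  have "(\<Sum>i<n. (norm (grad (f i) (dgd n f W \<alpha> k i)))\<^sup>2)
      \<le> (\<Sum>i<n. 2 * M * (f i (dgd n f W \<alpha> k i) - f i (xo i)))"
    by (intro sum_mono norm_grad_squared_le f_smooth assms) auto
  also have "\<dots> = 2 * M * ((\<Sum>i<n. f i (dgd n f W \<alpha> k i)) - (\<Sum>i<n. f i (xo i)))"
    by (simp only: sum_distrib_left[symmetric] sum_subtractf)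
  also have "\<dots> \<le> 2 * M * ((\<Sum>i<n. f i 0) - (\<Sum>i<n. f i (xo i)))"
    using sum_f_dgd_le[of k] M_pos by (intro mult_left_mono) auto
  finally show ?thesis .
qed

end

section \<open>Consensus and decrease of the averaged objective\<close>

text \<open>A division-free form of \<open>1 / r (Suc j) \<ge> 1 / r j + c\<close>. Positivity is
  assumed only before \<open>k\<close>, so the last value may be nonpositive and is treated
  separately.\<close>

lemma reciprocal_rate:
  fixes r :: "nat \<Rightarrow> real"
  assumes c: "0 < c" and step: "\<And>j. j < k \<Longrightarrow> 0 < r j \<and> r (Suc j) \<le> r j - c * (r j)\<^sup>2"
  shows "c * real k * r k \<le> 1"
  using step
proof (induction k)
  case (Suc k)
  let ?x = "r k" and ?y = "r (Suc k)"
  have IH: "c * real k * ?x \<le> 1" using Suc by simp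
  have x: "0 < ?x" and y: "?y \<le> ?x - c * ?x\<^sup>2" using Suc.prems[of k] by auto
  show ?case
  proof (cases "?y \<le> 0")
    case True
    then have "c * real (Suc k) * ?y \<le> 0" using c by (simp add: mult_nonneg_nonpos)
    then show ?thesis by simp
  next
    case False
    have "?y \<le> ?x" using y x c by (smt (verit) mult_nonneg_nonneg zero_le_power2)
    \<comment> \<open>Since \<open>?y \<le> ?x\<close>, one factor of the quadratic term may be
      replaced by \<open>?y\<close>, giving \<open>?y \<le> ?x * (1 - c * ?y)\<close>. Multiplied by
      \<open>c * k\<close>, the induction hypothesis then yields
      \<open>c * k * ?y \<le> 1 - c * ?y\<close>.\<close>
    then have "c * ?x * ?y \<le> c * ?x * ?x" using x c by (intro mult_left_mono) auto
    then have le: "?y \<le> ?x * (1 - c * ?y)" using y by (simp add: algebra_simps power2_eq_square)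
    then have "0 < ?x * (1 - c * ?y)" using False by simp
    then have pos: "0 < 1 - c * ?y" using x by (simp add: zero_less_mult_iff)
    have "c * real k * ?y \<le> c * real k * (?x * (1 - c * ?y))"
      using le c by (intro mult_left_mono) auto
    also have "\<dots> = (c * real k * ?x) * (1 - c * ?y)" by simp
    also have "\<dots> \<le> 1 * (1 - c * ?y)" using IH pos by (intro mult_right_mono) auto
    finally show ?thesis by (simp add: algebra_simps)
  qed
qed simp

section \<open>Gradient and smoothness of the averaged objective\<close>

lemma convex_smooth_mono:
  assumes "convex_smooth L g" "L \<le> M"
  shows "convex_smooth M g"
proof -
  have "norm (grad g x - grad g y) \<le> M * norm (x - y)" for x y
    using grad_lipschitz[OF assms(1), of x y] mult_right_mono[OF assms(2), of "norm (x - y)"]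
    by simp
  then show ?thesis using assms by (auto simp: convex_smooth_def)
qed

lemma grad_fbar:
  assumes "\<And>i. i < n \<Longrightarrow> convex_smooth (L i) (f i)"
  shows "GDERIV (fbar n f) x :> (1 / real n) *\<^sub>R (\<Sum>i<n. grad (f i) x)"
proof -
  have "((\<lambda>x. \<Sum>i<n. f i x) has_derivative (\<lambda>h. \<Sum>i<n. inner h (grad (f i) x))) (at x)"
  proof (rule has_derivative_sum)
    fix i assume "i \<in> {..<n}"
    then show "(f i has_derivative (\<lambda>h. inner h (grad (f i) x))) (at x)"
      using GDERIV_grad[of "f i" x] assms[of i] by (simp add: convex_smooth_def gderiv_def)
  qed
  then have "((\<lambda>x. (1 / real n) * (\<Sum>i<n. f i x)) has_derivative
      (\<lambda>h. (1 / real n) * (\<Sum>i<n. inner h (grad (f i) x)))) (at x)"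
    by (rule has_derivative_mult_right)
  then show ?thesis
    unfolding gderiv_def fbar_def[abs_def] inner_scaleR_right inner_sum_right by simp
qed

lemma convex_smooth_fbar:
  assumes n: "1 \<le> n" and f: "\<And>i. i < n \<Longrightarrow> convex_smooth (L i) (f i)"
  shows "convex_smooth (L_fbar n L) (fbar n f)"
  unfolding convex_smooth_def
proof (intro conjI allI)
  show "0 < L_fbar n L"
    unfolding L_fbar_def using n f
    by (intro mult_pos_pos sum_pos) (auto simp: convex_smooth_def lessThan_empty_iff)
  show "convex_on UNIV (fbar n f)"
  proof (rule convex_onI)
    fix t :: real and x y assume t: "0 < t" "t < 1"
    have "(\<Sum>i<n. f i ((1 - t) *\<^sub>R x + t *\<^sub>R y)) \<le> (\<Sum>i<n. (1 - t) * f i x + t * f i y)"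
      using f t by (intro sum_mono convex_onD) (auto simp: convex_smooth_def)
    then have "1 / real n * (\<Sum>i<n. f i ((1 - t) *\<^sub>R x + t *\<^sub>R y))
        \<le> 1 / real n * (\<Sum>i<n. (1 - t) * f i x + t * f i y)"
      by (intro mult_left_mono) auto
    then show "fbar n f ((1 - t) *\<^sub>R x + t *\<^sub>R y) \<le> (1 - t) * fbar n f x + t * fbar n f y"
      by (simp add: fbar_def sum.distrib sum_distrib_left[symmetric] add_divide_distrib)
  qed simp
  have gderiv: "GDERIV (fbar n f) x :> (1 / real n) *\<^sub>R (\<Sum>i<n. grad (f i) x)" for x
    using f by (rule grad_fbar)
  show "fbar n f differentiable (at x)" for x
    using gderiv[of x] unfolding gderiv_def differentiable_def by blast
  show "norm (grad (fbar n f) x - grad (fbar n f) y) \<le> L_fbar n L * norm (x - y)" for x y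
  proof -
    have "grad (fbar n f) x - grad (fbar n f) y
        = (1 / real n) *\<^sub>R (\<Sum>i<n. grad (f i) x - grad (f i) y)"
      by (simp add: grad_eq[OF gderiv] sum_subtractf scaleR_diff_right)
    also have "norm \<dots> \<le> 1 / real n * (\<Sum>i<n. L i * norm (x - y))"
    proof -
      have "norm (\<Sum>i<n. grad (f i) x - grad (f i) y) \<le> (\<Sum>i<n. L i * norm (x - y))"
        by (rule sum_norm_le) (simp add: grad_lipschitz f)
      then show ?thesis by (simp add: divide_right_mono)
    qed
    finally show ?thesis by (simp add: L_fbar_def sum_distrib_right)
  qed
qed

section \<open>The stacked norm and averages\<close>

lemma stack_norm_sqrt: "stack_norm n x = sqrt (\<Sum>i<n. (norm (x i))\<^sup>2)"
  by (simp add: stack_norm_def L2_set_def)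

lemma stack_norm_nonneg: "0 \<le> stack_norm n x"
  by (simp add: stack_norm_sqrt sum_nonneg)

lemma norm_le_stack_norm: "i < n \<Longrightarrow> norm (x i) \<le> stack_norm n x"
  unfolding stack_norm_def by (rule member_le_L2_set) auto

lemma stack_norm_add: "stack_norm n (\<lambda>i. x i + y i) \<le> stack_norm n x + stack_norm n y"
proof -
  have "stack_norm n (\<lambda>i. x i + y i) \<le> L2_set (\<lambda>i. norm (x i) + norm (y i)) {..<n}"
    unfolding stack_norm_def by (intro L2_set_mono norm_triangle_ineq) auto
  also have "\<dots> \<le> stack_norm n x + stack_norm n y"
    unfolding stack_norm_def by (rule L2_set_triangle_ineq)
  finally show ?thesis .
qed

lemma stack_norm_cong: "(\<And>i. i < n \<Longrightarrow> x i = y i) \<Longrightarrow> stack_norm n x = stack_norm n y"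
  by (simp add: stack_norm_sqrt)

lemma stack_norm_scaleR: "stack_norm n (\<lambda>i. c *\<^sub>R x i) = \<bar>c\<bar> * stack_norm n x"
  by (simp add: stack_norm_sqrt power_mult_distrib real_sqrt_mult flip: sum_distrib_left)

lemma norm_sum_le_stack_norm: "norm (\<Sum>i<n. x i) \<le> sqrt (real n) * stack_norm n x"
proof -
  have "norm (\<Sum>i<n. x i) \<le> (\<Sum>i<n. \<bar>1\<bar> * \<bar>norm (x i)\<bar>)"
    by (simp add: norm_sum)
  also have "\<dots> \<le> L2_set (\<lambda>_. 1) {..<n} * L2_set (\<lambda>i. norm (x i)) {..<n}"
    by (rule L2_set_mult_ineq)
  also have "\<dots> = sqrt (real n) * stack_norm n x"
    by (simp add: stack_norm_def L2_set_def)
  finally show ?thesis .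
qed

definition avg :: "nat \<Rightarrow> (nat \<Rightarrow> 'a::real_vector) \<Rightarrow> 'a" where
  "avg n x = (1 / real n) *\<^sub>R (\<Sum>i<n. x i)"

lemma avg_diff: "avg n (\<lambda>i. x i - y i) = avg n x - avg n y"
  by (simp add: avg_def sum_subtractf scaleR_diff_right)

lemma avg_scaleR: "avg n (\<lambda>i. c *\<^sub>R x i) = c *\<^sub>R avg n x"
  by (simp add: avg_def scaleR_sum_right mult.commute)

lemma sum_deviation: "1 \<le> n \<Longrightarrow> (\<Sum>i<n. x i - avg n x) = 0"
  by (simp add: avg_def sum_subtractf scaleR_sum_right[symmetric] sum_constant_scaleR)

text \<open>Subtracting the mean is an orthogonal projection: the squared norm drops by
  \<open>n * |avg n x|^2\<close>.\<close>

lemma stack_norm_deviation_le: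
  assumes "1 \<le> n"
  shows "stack_norm n (\<lambda>i. x i - avg n x) \<le> stack_norm n x"
proof -
  have s: "(\<Sum>i<n. x i) = real n *\<^sub>R avg n x" using assms by (simp add: avg_def)
  have "(\<Sum>i<n. (norm (x i - avg n x))\<^sup>2)
      = (\<Sum>i<n. (norm (x i))\<^sup>2) - 2 * inner (\<Sum>i<n. x i) (avg n x) + real n * (norm (avg n x))\<^sup>2"
    by (simp add: power2_norm_eq_inner inner_diff_left inner_diff_right inner_commute
        sum.distrib sum_subtractf inner_sum_left inner_sum_right algebra_simps sum_distrib_left)
  also have "\<dots> \<le> (\<Sum>i<n. (norm (x i))\<^sup>2)"
    unfolding s by (simp add: power2_norm_eq_inner)
  finally show ?thesis by (simp add: stack_norm_sqrt)
qed

lemma xbar_eq_avg: "xbar n f W \<alpha> k = avg n (dgd n f W \<alpha> k)"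
  by (simp add: xbar_def avg_def)

context mixing
begin

lemma beta_nonneg: "0 \<le> beta n W"
  by (simp add: beta_def)

lemma avg_mix: "avg n (mix n W x) = avg n x"
proof -
  have "(\<Sum>i<n. mix n W x i) = (\<Sum>j<n. (\<Sum>i<n. W $$ (i, j)) *\<^sub>R x j)"
    unfolding mix_def scaleR_sum_left by (rule sum.swap)
  then show ?thesis by (simp add: avg_def W_col)
qed

lemma mix_deviation: "i < n \<Longrightarrow> mix n W (\<lambda>i. x i - m) i = mix n W x i - m"
  by (simp add: mix_def scaleR_diff_right sum_subtractf W_row flip: scaleR_sum_left)

lemma stack_norm_mix_le:
  assumes "(\<Sum>i<n. x i) = 0"
  shows "stack_norm n (mix n W x) \<le> beta n W * stack_norm n x"
  using real_sqrt_le_mono[OF mix_contracts[OF assms]] beta_nonneg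
  by (simp add: stack_norm_sqrt real_sqrt_mult)

end

section \<open>The averaged iteration\<close>

context dgd_setting
begin

abbreviation grads :: "nat \<Rightarrow> nat \<Rightarrow> 'a" where
  "grads k \<equiv> \<lambda>i. grad (f i) (dgd n f W \<alpha> k i)"

text \<open>Columns of \<open>W\<close> sum to 1, so averaging removes the mixing. What remains is a
  gradient step on \<open>fbar\<close>, except that gradients are taken at the agents' points
  instead of their average.\<close>

lemma xbar_Suc: "xbar n f W \<alpha> (Suc k) = xbar n f W \<alpha> k - \<alpha> *\<^sub>R avg n (grads k)"
proof -
  have "dgd n f W \<alpha> (Suc k) = (\<lambda>i. mix n W (dgd n f W \<alpha> k) i - \<alpha> *\<^sub>R grads k i)"
    by (simp add: mix_def)
  then show ?thesis
    unfolding xbar_eq_avg by (simp only: avg_diff avg_scaleR avg_mix)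
qed

text \<open>Per update the deviation contracts by \<open>beta n W\<close> and gains at most
  \<open>\<alpha> * D\<close>; starting from zero, it stays below the fixed point of
  \<open>e = beta * e + \<alpha> * D\<close>.\<close>

lemma consensus:
  assumes D: "\<And>k. stack_norm n (grads k) \<le> D"
  shows "stack_norm n (\<lambda>i. dgd n f W \<alpha> k i - xbar n f W \<alpha> k) \<le> \<alpha> * D / (1 - beta n W)"
proof (induction k)
  case 0
  have "0 \<le> D" using D[of 0] stack_norm_nonneg order_trans by blast
  then show ?case using \<alpha>_pos W_beta by (simp add: xbar_def stack_norm_sqrt)
next
  case (Suc k)
  let ?x = "dgd n f W \<alpha> k" and ?b = "beta n W"
  let ?y = "\<lambda>i. ?x i - avg n ?x" and ?g = "\<lambda>i. grads k i - avg n (grads k)"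
  have "stack_norm n (\<lambda>i. dgd n f W \<alpha> (Suc k) i - xbar n f W \<alpha> (Suc k))
      = stack_norm n (\<lambda>i. mix n W ?y i + (- \<alpha>) *\<^sub>R ?g i)"
  proof (rule stack_norm_cong)
    fix i assume "i < n"
    then show "dgd n f W \<alpha> (Suc k) i - xbar n f W \<alpha> (Suc k) = mix n W ?y i + (- \<alpha>) *\<^sub>R ?g i"
      unfolding xbar_Suc by (simp add: mix_deviation xbar_eq_avg mix_def[of n W ?x] algebra_simps)
  qed
  also have "\<dots> \<le> stack_norm n (mix n W ?y) + \<alpha> * stack_norm n ?g"
    using stack_norm_add[of n "mix n W ?y" "\<lambda>i. (- \<alpha>) *\<^sub>R ?g i"] \<alpha>_pos
    unfolding stack_norm_scaleR by simp
  also have "\<dots> \<le> ?b * (\<alpha> * D / (1 - ?b)) + \<alpha> * D"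
  proof (rule add_mono)
    show "stack_norm n (mix n W ?y) \<le> ?b * (\<alpha> * D / (1 - ?b))"
      using stack_norm_mix_le[OF sum_deviation[OF n_pos]] mult_left_mono[OF Suc.IH beta_nonneg]
      unfolding xbar_eq_avg by (rule order_trans)
    show "\<alpha> * stack_norm n ?g \<le> \<alpha> * D"
      using stack_norm_deviation_le[OF n_pos, of "grads k"] D[of k] \<alpha>_pos
      by (intro mult_left_mono) auto
  qed
  also have "\<dots> = \<alpha> * D / (1 - ?b)" using W_beta by (simp add: field_simps)
  finally show ?case .
qed

lemma gradient_error:
  assumes D: "\<And>k. stack_norm n (grads k) \<le> D"
  shows "norm (grad (fbar n f) (xbar n f W \<alpha> k) - avg n (grads k)) \<le> \<alpha> * M * D / (1 - beta n W)"
proof -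
  let ?z = "xbar n f W \<alpha> k"
  have "norm (\<Sum>i<n. grad (f i) ?z - grads k i) \<le> (\<Sum>i<n. M * (\<alpha> * D / (1 - beta n W)))"
  proof (rule sum_norm_le)
    fix i assume "i \<in> {..<n}"
    then have i: "i < n" by simp
    have "norm (grad (f i) ?z - grads k i) \<le> M * norm (?z - dgd n f W \<alpha> k i)"
      by (rule grad_lipschitz[OF f_smooth[OF i]])
    \<comment> \<open>One agent's deviation is bounded by the whole stacked deviation; the
      \<open>n\<close> equal bounds are later averaged, so no factor \<open>n\<close>
      remains.\<close>
    also have "\<dots> \<le> M * (\<alpha> * D / (1 - beta n W))"
      using norm_le_stack_norm[OF i, of "\<lambda>i. dgd n f W \<alpha> k i - ?z"] consensus[OF D, of k] M_pos
      by (intro mult_left_mono) (auto simp: norm_minus_commute)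
    finally show "norm (grad (f i) ?z - grads k i) \<le> M * (\<alpha> * D / (1 - beta n W))" .
  qed
  moreover have "grad (fbar n f) ?z - avg n (grads k)
      = (1 / real n) *\<^sub>R (\<Sum>i<n. grad (f i) ?z - grads k i)"
    by (subst grad_eq[OF grad_fbar[of n "\<lambda>_. M"]])
      (simp_all add: f_smooth avg_def sum_subtractf scaleR_diff_right)
  ultimately show ?thesis
    using n_pos by (simp add: divide_le_eq mult_ac)
qed

text \<open>The triangle inequality goes through \<open>xt\<close>, from which the iterates are
  never farther than at the start. Cauchy-Schwarz for the mean produces the factor
  \<open>1 / sqrt n\<close> of \<open>C_const\<close>.\<close>

lemma xbar_distance_le:
  assumes "minimizer (xi n f W \<alpha>) xt"
  shows "norm (xbar n f W \<alpha> k - xs) \<le> C_const n f W \<alpha> xt xs"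
proof -
  let ?x = "dgd n f W \<alpha> k"
  have "xbar n f W \<alpha> k - xs = avg n (\<lambda>i. ?x i - xs)"
    using n_pos by (simp add: avg_diff xbar_eq_avg) (simp add: avg_def sum_constant_scaleR)
  also have "norm \<dots> \<le> 1 / real n * (sqrt (real n) * stack_norm n (\<lambda>i. ?x i - xs))"
    using norm_sum_le_stack_norm[of "\<lambda>i. ?x i - xs" n] by (simp add: avg_def divide_right_mono)
  also have "\<dots> = 1 / sqrt (real n) * stack_norm n (\<lambda>i. ?x i - xs)"
  proof -
    have "1 / (q * q) * (q * s) = 1 / q * s" if "q \<noteq> 0" for q s :: real
      using that by simp
    from this[of "sqrt (real n)"] show ?thesis using n_pos by simp
  qed
  also have "\<dots> \<le> C_const n f W \<alpha> xt xs"
    unfolding C_const_def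
  proof (rule mult_left_mono)
    have "stack_norm n (\<lambda>i. ?x i - xs) \<le> stack_norm n (\<lambda>i. ?x i - xt i) + stack_norm n (\<lambda>i. xt i - xs)"
      using stack_norm_add[of n "\<lambda>i. ?x i - xt i" "\<lambda>i. xt i - xs"] by simp
    also have "stack_norm n (\<lambda>i. ?x i - xt i) \<le> stack_norm n (\<lambda>i. dgd n f W \<alpha> 0 i - xt i)"
      unfolding stack_norm_sqrt
      by (rule real_sqrt_le_mono[OF dgd_distance_nonincreasing[OF assms]])
    finally show "stack_norm n (\<lambda>i. ?x i - xs)
        \<le> stack_norm n (\<lambda>i. dgd n f W \<alpha> 0 i - xt i) + stack_norm n (\<lambda>i. xt i - xs)" by simp
  qed simp
  finally show ?thesis .
qed

lemma rbar_decrease: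
  assumes smooth: "convex_smooth Lf (fbar n f)" and \<alpha>: "\<alpha> * Lf \<le> 1"
    and D: "\<And>k. stack_norm n (grads k) \<le> D"
    and xt: "minimizer (xi n f W \<alpha>) xt"
    and large: "C_const n f W \<alpha> xt xs * sqrt 2 * (\<alpha> * M * D / (1 - beta n W)) < rbar n f W \<alpha> xs k"
  shows "0 < rbar n f W \<alpha> xs k" "0 < C_const n f W \<alpha> xt xs"
    and "rbar n f W \<alpha> xs (Suc k)
      \<le> rbar n f W \<alpha> xs k - \<alpha> * (rbar n f W \<alpha> xs k)\<^sup>2 / (4 * (C_const n f W \<alpha> xt xs)\<^sup>2)"
proof -
  define C where "C = C_const n f W \<alpha> xt xs"
  define e where "e = \<alpha> * M * D / (1 - beta n W)"
  define z where "z = xbar n f W \<alpha> k"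
  define G where "G = grad (fbar n f) z"
  define E where "E = avg n (grads k)"
  define r where "r = rbar n f W \<alpha> xs k"
  have dist: "norm (z - xs) \<le> C" unfolding z_def C_def by (rule xbar_distance_le[OF xt])
  have err: "norm (G - E) \<le> e" unfolding G_def z_def E_def e_def by (rule gradient_error[OF D])
  \<comment> \<open>Both constants bound a norm, hence are nonnegative; exceeding the threshold then
    makes \<open>r\<close> positive.\<close>
  have C0: "0 \<le> C" and e0: "0 \<le> e" using dist err norm_ge_zero order_trans by blast+
  have Cer: "C * sqrt 2 * e < r" using large by (simp add: C_def e_def r_def)
  have r0: "0 < r" using Cer C0 e0 by (smt (verit) mult_nonneg_nonneg real_sqrt_ge_zero)
  then show "0 < rbar n f W \<alpha> xs k" by (simp add: r_def)
  have "r \<le> inner G (z - xs)"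
    using convex_above_tangent[OF smooth, of z xs]
    by (simp add: r_def rbar_def G_def z_def inner_diff_right)
  also have "\<dots> \<le> norm G * norm (z - xs)" by (rule norm_cauchy_schwarz)
  also have "\<dots> \<le> norm G * C" by (rule mult_left_mono[OF dist norm_ge_zero])
  finally have rG: "r \<le> norm G * C" .
  then have Cpos: "0 < C" using r0 C0 by (cases "C = 0") auto
  then show "0 < C_const n f W \<alpha> xt xs" by (simp add: C_def)
  have "r\<^sup>2 \<le> (norm G * C)\<^sup>2" using rG r0 by (intro power_mono) auto
  then have G2: "r\<^sup>2 / C\<^sup>2 \<le> (norm G)\<^sup>2" using Cpos by (simp add: power_mult_distrib field_simps)
  \<comment> \<open>The factor \<open>sqrt 2\<close> in the threshold makes the squared gradient
    error at most half of \<open>r^2 / C^2\<close>, the lower bound for the squared true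
    gradient.\<close>
  have "C * sqrt 2 * norm (G - E) \<le> C * sqrt 2 * e"
    using Cpos by (intro mult_left_mono err) auto
  then have "C * sqrt 2 * norm (G - E) \<le> r" using Cer by linarith
  then have "(C * sqrt 2 * norm (G - E))\<^sup>2 \<le> r\<^sup>2" using Cpos by (intro power_mono) auto
  then have E2: "(norm (G - E))\<^sup>2 \<le> r\<^sup>2 / (2 * C\<^sup>2)"
    using Cpos by (simp add: power_mult_distrib field_simps)
  have "fbar n f (xbar n f W \<alpha> (Suc k)) = fbar n f (z + (- \<alpha>) *\<^sub>R E)"
    by (simp add: xbar_Suc z_def E_def)
  also have "\<dots> \<le> fbar n f z + inner G ((- \<alpha>) *\<^sub>R E) + Lf / 2 * (norm ((- \<alpha>) *\<^sub>R E))\<^sup>2"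
    unfolding G_def by (rule descent_lemma[OF smooth])
  also have "Lf / 2 * (norm ((- \<alpha>) *\<^sub>R E))\<^sup>2 = (\<alpha> * Lf) * (\<alpha> / 2 * (norm E)\<^sup>2)"
    by (simp add: power_mult_distrib power2_eq_square)
  also have "\<dots> \<le> 1 * (\<alpha> / 2 * (norm E)\<^sup>2)" using \<alpha> \<alpha>_pos by (intro mult_right_mono) auto
  finally have "fbar n f (xbar n f W \<alpha> (Suc k))
      \<le> fbar n f z - \<alpha> * inner G E + \<alpha> / 2 * (norm E)\<^sup>2" by simp
  \<comment> \<open>Polarization:
    \<open>- <G, E> + |E|^2 / 2 = (|G - E|^2 - |G|^2) / 2\<close>.\<close>
  also have "\<dots> = fbar n f z + \<alpha> / 2 * ((norm (G - E))\<^sup>2 - (norm G)\<^sup>2)"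
    by (simp add: power2_norm_eq_inner inner_diff_left inner_diff_right inner_commute field_simps)
  \<comment> \<open>Half of the gradient term survives the error; together with the factor
    \<open>\<alpha> / 2\<close> this gives the 1/4 of the decrease.\<close>
  also have "\<dots> \<le> fbar n f z + \<alpha> / 2 * (r\<^sup>2 / (2 * C\<^sup>2) - r\<^sup>2 / C\<^sup>2)"
    using E2 G2 \<alpha>_pos by (intro add_left_mono mult_left_mono diff_mono) auto
  also have "\<dots> = fbar n f z - \<alpha> * r\<^sup>2 / (4 * C\<^sup>2)" using Cpos by (simp add: field_simps)
  finally show "rbar n f W \<alpha> xs (Suc k)
      \<le> rbar n f W \<alpha> xs k - \<alpha> * (rbar n f W \<alpha> xs k)\<^sup>2 / (4 * (C_const n f W \<alpha> xt xs)\<^sup>2)"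
    by (simp add: r_def[symmetric] C_def[symmetric]) (simp add: r_def rbar_def z_def)
qed

end

section \<open>From the assumptions to uniform constants\<close>

lemma L_le_L_h: "i < n \<Longrightarrow> L i \<le> L_h n L"
  unfolding L_h_def by (rule Max_ge) auto

lemma local_objectives_convex_smooth:
  assumes "local_objectives n f L" "i < n"
  shows "convex_smooth (L i) (f i)"
proof -
  have *: "convex_on UNIV (f i)" "\<forall>x. f i differentiable (at x)" "0 < L i"
    and lip: "lipschitz_on (L i) UNIV (grad (f i))"
    using assms by (simp_all add: local_objectives_def)
  have "norm (grad (f i) x - grad (f i) y) \<le> L i * norm (x - y)" for x y
    using lipschitz_onD[OF lip, of x y] by (simp add: dist_norm)
  then show ?thesis using * by (simp add: convex_smooth_def)
qed

lemma local_objectives_convex_smooth_L_h: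
  assumes "local_objectives n f L" "i < n"
  shows "convex_smooth (L_h n L) (f i)"
  using local_objectives_convex_smooth[OF assms] L_le_L_h[OF assms(2)] by (rule convex_smooth_mono)

text \<open>The order of quantifiers carries the O-notation: \<open>a\<close> is absolute, while
  \<open>c1\<close>, \<open>c2\<close>, \<open>c3\<close> may depend on the objectives and on
  \<open>B\<close>, but not on the network, \<open>W\<close>, \<open>\<alpha>\<close>, the
  minimizers or \<open>k\<close>. \<open>B\<close> is there because \<open>C_const\<close> varies
  with \<open>W\<close> and \<open>\<alpha>\<close> through \<open>xt\<close>. In the last clause
  \<open>rbar\<close> may already be below the threshold at \<open>k\<close> itself.\<close>

theorem theorem2:
  shows "\<exists>a>0. \<forall>n (f :: nat \<Rightarrow> 'a::euclidean_space \<Rightarrow> real) L xo.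
    1 \<le> n \<and> local_objectives n f L \<and> (\<forall>i<n. minimizer (f i) (xo i)) \<longrightarrow>
    (\<forall>B. \<exists>c1>0. \<exists>c2>0. \<exists>c3>0. \<forall>E W \<alpha> xt xs.
      connected_network n E \<and> mixing_matrix n E W \<and>
      minimizer (xi n f W \<alpha>) xt \<and> minimizer (\<lambda>x. \<Sum>i<n. f i x) xs \<and>
      C_const n f W \<alpha> xt xs \<le> B \<and>
      0 < \<alpha> \<and> \<alpha> \<le> step_bound n L W \<longrightarrow>
        step_bound n L W \<le> a / L_h n L \<and>
        threshold n f L xo W \<alpha> xt xs \<le> c1 * (\<alpha> / (1 - beta n W)) \<and>
        (\<forall>k. threshold n f L xo W \<alpha> xt xs < rbar n f W \<alpha> xs k \<longrightarrow>
             rbar n f W \<alpha> xs (Suc k) \<le> rbar n f W \<alpha> xs k - c2 * (\<alpha> * (rbar n f W \<alpha> xs k)\<^sup>2)) \<and>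
        (\<forall>k\<ge>1. (\<forall>j<k. threshold n f L xo W \<alpha> xt xs < rbar n f W \<alpha> xs j) \<longrightarrow>
             rbar n f W \<alpha> xs k \<le> c3 * (1 / (\<alpha> * real k))))"
\<comment> \<open>The witness 2 bounds \<open>1 + eigval W n\<close>.\<close>
proof (rule exI[of _ 2], intro conjI allI impI, goal_cases)
  case 1
  show ?case by simp
next
  case (2 n f L xo B)
  then have n: "1 \<le> n" and lo: "local_objectives n f L"
    and xo: "\<And>i. i < n \<Longrightarrow> minimizer (f i) (xo i)" by auto
  define M where "M = L_h n L"
  define D where "D = D_const n f L xo"
  \<comment> \<open>A lower bound for every \<open>1 / (4 * C^2)\<close> with
    \<open>0 < C \<le> B\<close>; the added 1 keeps it positive when \<open>B = 0\<close>.\<close>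
  define c where "c = 1 / (4 * B\<^sup>2 + 1)"
  have f: "convex_smooth (L i) (f i)" "convex_smooth M (f i)" if "i < n" for i
    using local_objectives_convex_smooth[OF lo that] local_objectives_convex_smooth_L_h[OF lo that]
    by (auto simp: M_def)
  have M: "0 < M" using f(2)[of 0] n by (simp add: convex_smooth_def)
  have fo: "(\<Sum>i<n. f i (xo i)) \<le> (\<Sum>i<n. f i 0)"
    using xo by (intro sum_mono) (auto simp: is_arg_min_linorder)
  have D0: "0 \<le> D" using fo M by (simp add: D_def D_const_def M_def)
  have c: "0 < c" unfolding c_def by (intro divide_pos_pos add_nonneg_pos) auto
  have smooth: "convex_smooth (L_fbar n L) (fbar n f)" by (rule convex_smooth_fbar[OF n f(1)])
  show ?case
  \<comment> \<open>The absolute value and the added 1 make \<open>c1\<close> positive whatever the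
    sign of \<open>B\<close>, even when \<open>D = 0\<close>.\<close>
  proof (rule exI[of _ "\<bar>B\<bar> * sqrt 2 * M * D + 1"], rule conjI, goal_cases)
    case 1
    show ?case using M D0 by (intro add_nonneg_pos mult_nonneg_nonneg) auto
  next
    case 2
    show ?case
    \<comment> \<open>\<open>c3\<close> is the reciprocal of \<open>c2\<close> because
      \<open>reciprocal_rate\<close> is applied with the constant
      \<open>c * \<alpha>\<close>.\<close>
    proof (rule exI[of _ c], rule conjI[OF c], rule exI[of _ "1 / c"], rule conjI, goal_cases)
      case 1
      show ?case using c by simp
    next
      case 2
      show ?case
      proof (intro allI impI, goal_cases)
        case (1 E W \<alpha> xt xs)
        then have W: "mixing_matrix n E W" and xt: "minimizer (xi n f W \<alpha>) xt"
          and CB: "C_const n f W \<alpha> xt xs \<le> B" and \<alpha>: "0 < \<alpha>" "\<alpha> \<le> step_bound n L W"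
          by auto
        interpret mixing n W
          using W n by unfold_locales (auto simp: mixing_matrix_def)
        have Lf: "0 < L_fbar n L" using smooth by (simp add: convex_smooth_def)
        have "\<alpha> \<le> (1 + eigval W n) / M" "\<alpha> \<le> 1 / L_fbar n L"
          using \<alpha> by (auto simp: step_bound_def M_def)
        then have \<alpha>M: "\<alpha> * M \<le> 1 + eigval W n" and \<alpha>L: "\<alpha> * L_fbar n L \<le> 1"
          using M Lf by (auto simp: field_simps)
        interpret dgd_setting n W f M \<alpha>
          using f \<alpha> \<alpha>M by unfold_locales auto
        define T where "T = threshold n f L xo W \<alpha> xt xs"
        define r where "r = rbar n f W \<alpha> xs"
        have T: "T = C_const n f W \<alpha> xt xs * sqrt 2 * (\<alpha> * M * D / (1 - beta n W))"
          by (simp add: T_def threshold_def M_def D_def)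
        have grads_le: "stack_norm n (grads k) \<le> D" for k
          using real_sqrt_le_mono[OF sum_grad_dgd_le[of xo k]] xo
          by (simp add: stack_norm_sqrt D_def D_const_def M_def)
        have bound: "step_bound n L W \<le> 2 / L_h n L"
        proof -
          have "step_bound n L W \<le> (1 + eigval W n) / M" by (simp add: step_bound_def M_def)
          also have "\<dots> \<le> 2 / M" using eigval_n_less_1 M by (intro divide_right_mono) auto
          finally show ?thesis by (simp add: M_def)
        qed
        have T_le: "T \<le> (\<bar>B\<bar> * sqrt 2 * M * D + 1) * (\<alpha> / (1 - beta n W))"
        proof -
          have "T = (C_const n f W \<alpha> xt xs * (sqrt 2 * M * D)) * (\<alpha> / (1 - beta n W))"
            by (simp add: T)
          also have "\<dots> \<le> (\<bar>B\<bar> * (sqrt 2 * M * D) + 1) * (\<alpha> / (1 - beta n W))"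
          proof (rule mult_right_mono)
            have "C_const n f W \<alpha> xt xs * (sqrt 2 * M * D) \<le> \<bar>B\<bar> * (sqrt 2 * M * D)"
              using CB M D0 by (intro mult_right_mono) auto
            then show "C_const n f W \<alpha> xt xs * (sqrt 2 * M * D) \<le> \<bar>B\<bar> * (sqrt 2 * M * D) + 1"
              by linarith
          qed (use \<alpha> W_beta in auto)
          finally show ?thesis by (simp add: mult.assoc)
        qed
        have dec: "0 < r k \<and> r (Suc k) \<le> r k - c * (\<alpha> * (r k)\<^sup>2)" if "T < r k" for k
        proof -
          note * = rbar_decrease[OF smooth \<alpha>L grads_le xt that[unfolded T r_def], folded r_def]
          have "(C_const n f W \<alpha> xt xs)\<^sup>2 \<le> B\<^sup>2" using CB *(2) by (intro power_mono) auto
          then have "c \<le> 1 / (4 * (C_const n f W \<alpha> xt xs)\<^sup>2)"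
            unfolding c_def using *(2) by (intro divide_left_mono mult_pos_pos add_nonneg_pos) auto
          then have "c * (\<alpha> * (r k)\<^sup>2) \<le> 1 / (4 * (C_const n f W \<alpha> xt xs)\<^sup>2) * (\<alpha> * (r k)\<^sup>2)"
            using \<alpha> by (intro mult_right_mono) auto
          then show ?thesis using * by simp
        qed
        have rate: "r k \<le> 1 / c * (1 / (\<alpha> * real k))" if "1 \<le> k" "\<forall>j<k. T < r j" for k
        proof -
          have "c * \<alpha> * real k * r k \<le> 1"
            using dec that \<alpha> c by (intro reciprocal_rate) (auto simp: mult.assoc)
          then show ?thesis using that \<alpha> c by (simp add: field_simps)
        qed
        show ?case
          using bound T_le dec rate unfolding T_def r_def by blast
      qed
    qed
  qed
qed

end
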